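(* (a) Let $\Pi$ be a partition of $\mathbb N$ of type $(\infty^{k_\infty},1^{k_1},2^{k_2},\ldots)$ with finitely many finite blocks, i.e. $k_1+k_2+\ldots<\infty$. Then the representation $I_\Pi=\operatorname{Ind}_{\mathfrak S_\Pi}^{\mathfrak S_{\mathbb N}}1_{\mathfrak S_\Pi}$ of the infinite symmetric group $\mathfrak S_{\mathbb N}$ is of type I and decomposes into a finite sum of irreducible representations. (b) Let $\Pi$ be a partition of $\mathbb N$ of type $(\infty^{k_\infty},1^{k_1},2^{k_2},\ldots)$. The representation $I_\Pi$ is irreducible if and only if $\Pi$ contains at most one finite block, that is, $k_1+k_2+\ldots\le 1$.
   Context: $\mathbb N$ is the set of positive integers and $\mathfrak S_{\mathbb N}=\bigcup_{n\ge1}\mathfrak S_n$ is the infinite symmetric group, i.e. the (discrete) group of finite permutations of $\mathbb N$ (those moving only finitely many elements). For a partition $\Pi=(A_1,A_2,\ldots)$ of $\mathbb N$ into disjoint nonempty subsets (blocks), the corresponding Young subgroup is $\mathfrak S_\Pi=\mathfrak S_{A_1}\times\mathfrak S_{A_2}\times\cdots\subset\mathfrak S_{\mathbb N}$, where $\mathfrak S_A$ is the group of all finite permutations of the elements of $A$; thus $\mathfrak S_\Pi$ is the group of finite permutations of $\mathbb N$ mapping each block to itself. For $i\in\{1,2,\ldots,\infty\}$ let $k_i\in\{0,1,2,\ldots,\infty\}$ be the number of blocks $A_j$ with $|A_j|=i$; then $\Pi$ and $\mathfrak S_\Pi$ are said to be of type $(\infty^{k_\infty},1^{k_1},2^{k_2},\ldots)$.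 The induced representation $I_\Pi=\operatorname{Ind}_{\mathfrak S_\Pi}^{\mathfrak S_{\mathbb N}}1_{\mathfrak S_\Pi}$ (induced from the identity representation of $\mathfrak S_\Pi$) is the unitary representation of $\mathfrak S_{\mathbb N}$ by left translations in $l^2(\mathfrak S_{\mathbb N}/\mathfrak S_\Pi)$. A unitary representation is of type I if the von Neumann algebra generated by its operators is of type I. *)

theory Defs
  imports
    "HOL-Analysis.Analysis"
    "HOL-Algebra.Sym_Groups"
    "HOL-Algebra.Left_Coset"
begin

section \<open>The Hilbert space \<open>l\<^sup>2(X)\<close>\<close>

text \<open>
  Vectors of \<open>l\<^sup>2(X)\<close> are functions on the whole type that vanish off \<open>X\<close>.
  Every complex Hilbert space is isometrically isomorphic to some \<open>l\<^sup>2(X)\<close>.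
\<close>

definition l2 :: "'x set \<Rightarrow> ('x \<Rightarrow> complex) set" where
  "l2 X = {f. (\<forall>x. x \<notin> X \<longrightarrow> f x = 0) \<and> (\<lambda>x. (cmod (f x))\<^sup>2) summable_on X}"

definition l2_inner :: "'x set \<Rightarrow> ('x \<Rightarrow> complex) \<Rightarrow> ('x \<Rightarrow> complex) \<Rightarrow> complex" where
  "l2_inner X f g = (\<Sum>\<^sub>\<infinity>x\<in>X. f x * cnj (g x))"

definition l2_norm :: "'x set \<Rightarrow> ('x \<Rightarrow> complex) \<Rightarrow> real" where
  "l2_norm X f = sqrt (\<Sum>\<^sub>\<infinity>x\<in>X. (cmod (f x))\<^sup>2)"

definition closed_subspace :: "'x set \<Rightarrow> ('x \<Rightarrow> complex) set \<Rightarrow> bool" where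
  "closed_subspace X V \<longleftrightarrow>
     V \<subseteq> l2 X \<and> (\<lambda>x. 0) \<in> V \<and>
     (\<forall>f\<in>V. \<forall>g\<in>V. (\<lambda>x. f x + g x) \<in> V) \<and>
     (\<forall>c. \<forall>f\<in>V. (\<lambda>x. c * f x) \<in> V) \<and>
     (\<forall>s f. (\<forall>n::nat. s n \<in> V) \<and> f \<in> l2 X \<and>
        (\<lambda>n. l2_norm X (\<lambda>x. s n x - f x)) \<longlonglongrightarrow> 0 \<longrightarrow> f \<in> V)"

section \<open>Bounded operators and von Neumann algebras\<close>

text \<open>
  Operators are extensional functions on \<^term>\<open>l2 X\<close>, so that equality of operators is
  equality of functions; their product is \<^term>\<open>compose (l2 X)\<close> and the identity operator is
  \<^term>\<open>\<lambda>f\<in>l2 X. f\<close>.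
\<close>

type_synonym 'x operator = "('x \<Rightarrow> complex) \<Rightarrow> ('x \<Rightarrow> complex)"

definition bounded_ops :: "'x set \<Rightarrow> 'x operator set" where
  "bounded_ops X = {T \<in> l2 X \<rightarrow>\<^sub>E l2 X.
     (\<forall>f\<in>l2 X. \<forall>g\<in>l2 X. T (\<lambda>x. f x + g x) = (\<lambda>x. T f x + T g x)) \<and>
     (\<forall>c. \<forall>f\<in>l2 X. T (\<lambda>x. c * f x) = (\<lambda>x. c * T f x)) \<and>
     (\<exists>C. \<forall>f\<in>l2 X. l2_norm X (T f) \<le> C * l2_norm X f)}"

definition is_adjoint :: "'x set \<Rightarrow> 'x operator \<Rightarrow> 'x operator \<Rightarrow> bool" where
  "is_adjoint X T S \<longleftrightarrow> (\<forall>f\<in>l2 X. \<forall>g\<in>l2 X. l2_inner X (T f) g = l2_inner X f (S g))"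

definition commutant :: "'x set \<Rightarrow> 'x operator set \<Rightarrow> 'x operator set" where
  "commutant X M = {T \<in> bounded_ops X. \<forall>S\<in>M. compose (l2 X) T S = compose (l2 X) S T}"

text \<open>
  Dixmier's definition: a self-adjoint set of operators equal to its bicommutant. Being a
  commutant, such a set is automatically a subalgebra containing the identity.
\<close>

definition von_neumann_algebra :: "'x set \<Rightarrow> 'x operator set \<Rightarrow> bool" where
  "von_neumann_algebra X M \<longleftrightarrow>
     M \<subseteq> bounded_ops X \<and> (\<forall>T\<in>M. \<exists>S\<in>M. is_adjoint X T S) \<and>
     commutant X (commutant X M) = M"

definition von_neumann_generated :: "'x set \<Rightarrow> 'x operator set \<Rightarrow> 'x operator set" where
  "von_neumann_generated X S = \<Inter>{M. von_neumann_algebra X M \<and> S \<subseteq> M}"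

definition projections :: "'x set \<Rightarrow> 'x operator set \<Rightarrow> 'x operator set" where
  "projections X M = {p \<in> M. compose (l2 X) p p = p \<and> is_adjoint X p p}"

definition abelian_projection :: "'x set \<Rightarrow> 'x operator set \<Rightarrow> 'x operator \<Rightarrow> bool" where
  "abelian_projection X M e \<longleftrightarrow>
     e \<in> projections X M \<and>
     (let corner = (\<lambda>T. compose (l2 X) e (compose (l2 X) T e)) ` M
      in \<forall>S\<in>corner. \<forall>T\<in>corner. compose (l2 X) S T = compose (l2 X) T S)"

text \<open>
  \<open>M\<close> is of type I if every nonzero central projection of \<open>M\<close> majorizes a nonzero abelian
  projection of \<open>M\<close>; for projections, \<open>e \<le> z\<close> means \<open>z e = e\<close>.
\<close>

definition type_I_algebra :: "'x set \<Rightarrow> 'x operator set \<Rightarrow> bool" where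
  "type_I_algebra X M \<longleftrightarrow>
     von_neumann_algebra X M \<and>
     (\<forall>z \<in> projections X (M \<inter> commutant X M). z \<noteq> (\<lambda>f\<in>l2 X. \<lambda>x. 0) \<longrightarrow>
        (\<exists>e. abelian_projection X M e \<and> e \<noteq> (\<lambda>f\<in>l2 X. \<lambda>x. 0) \<and> compose (l2 X) z e = e))"

section \<open>Unitary representations of discrete groups\<close>

definition unitary_ops :: "'x set \<Rightarrow> 'x operator set" where
  "unitary_ops X = {T \<in> bounded_ops X. T ` l2 X = l2 X \<and>
     (\<forall>f\<in>l2 X. \<forall>g\<in>l2 X. l2_inner X (T f) (T g) = l2_inner X f g)}"

definition unitary_rep :: "('g, 'b) monoid_scheme \<Rightarrow> 'x set \<Rightarrow> ('g \<Rightarrow> 'x operator) \<Rightarrow> bool" where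
  "unitary_rep G X U \<longleftrightarrow>
     (\<forall>g\<in>carrier G. U g \<in> unitary_ops X) \<and> U \<one>\<^bsub>G\<^esub> = (\<lambda>f\<in>l2 X. f) \<and>
     (\<forall>g\<in>carrier G. \<forall>h\<in>carrier G. U (g \<otimes>\<^bsub>G\<^esub> h) = compose (l2 X) (U g) (U h))"

definition type_I_rep :: "('g, 'b) monoid_scheme \<Rightarrow> 'x set \<Rightarrow> ('g \<Rightarrow> 'x operator) \<Rightarrow> bool" where
  "type_I_rep G X U \<longleftrightarrow>
     unitary_rep G X U \<and> type_I_algebra X (von_neumann_generated X (U ` carrier G))"

text \<open>The subrepresentations of \<open>U\<close> are its restrictions to closed invariant subspaces.\<close>

definition invariant_subspace ::
    "('g, 'b) monoid_scheme \<Rightarrow> 'x set \<Rightarrow> ('g \<Rightarrow> 'x operator) \<Rightarrow> ('x \<Rightarrow> complex) set \<Rightarrow> bool" where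
  "invariant_subspace G X U V \<longleftrightarrow>
     closed_subspace X V \<and> (\<forall>g\<in>carrier G. \<forall>f\<in>V. U g f \<in> V)"

definition irreducible_subrep ::
    "('g, 'b) monoid_scheme \<Rightarrow> 'x set \<Rightarrow> ('g \<Rightarrow> 'x operator) \<Rightarrow> ('x \<Rightarrow> complex) set \<Rightarrow> bool" where
  "irreducible_subrep G X U V \<longleftrightarrow>
     invariant_subspace G X U V \<and> V \<noteq> {\<lambda>x. 0} \<and>
     (\<forall>W. invariant_subspace G X U W \<and> W \<subseteq> V \<longrightarrow> W = {\<lambda>x. 0} \<or> W = V)"

definition irreducible_rep :: "('g, 'b) monoid_scheme \<Rightarrow> 'x set \<Rightarrow> ('g \<Rightarrow> 'x operator) \<Rightarrow> bool" where
  "irreducible_rep G X U \<longleftrightarrow> unitary_rep G X U \<and> irreducible_subrep G X U (l2 X)"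

definition finite_sum_of_irreducibles ::
    "('g, 'b) monoid_scheme \<Rightarrow> 'x set \<Rightarrow> ('g \<Rightarrow> 'x operator) \<Rightarrow> bool" where
  "finite_sum_of_irreducibles G X U \<longleftrightarrow>
     unitary_rep G X U \<and>
     (\<exists>(n::nat) V.
        (\<forall>i<n. irreducible_subrep G X U (V i)) \<and>
        (\<forall>i<n. \<forall>j<n. i \<noteq> j \<longrightarrow> (\<forall>f\<in>V i. \<forall>g\<in>V j. l2_inner X f g = 0)) \<and>
        (\<forall>f\<in>l2 X. \<exists>v. (\<forall>i<n. v i \<in> V i) \<and> f = (\<lambda>x. \<Sum>i<n. v i x)))"

section \<open>Young subgroups of the infinite symmetric group and their induced representations\<close>

definition sym_group_inf :: "(nat \<Rightarrow> nat) monoid" where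
  "sym_group_inf = \<lparr>carrier = (\<Union>n\<in>{1..}. carrier (sym_group n)), mult = (\<circ>), one = id\<rparr>"

definition young_subgroup :: "nat set set \<Rightarrow> (nat \<Rightarrow> nat) set" where
  "young_subgroup P = {p \<in> carrier sym_group_inf. \<forall>A\<in>P. p ` A = A}"

definition ecard :: "'a set \<Rightarrow> enat" where
  "ecard A = (if finite A then enat (card A) else \<infinity>)"

definition partition_of_type :: "nat set set \<Rightarrow> (enat \<Rightarrow> enat) \<Rightarrow> bool" where
  "partition_of_type P k \<longleftrightarrow>
     partition_on {1..} P \<and> (\<forall>i\<ge>1. k i = ecard {A\<in>P. ecard A = i})"

text \<open>
  The representation of \<open>G\<close> induced from the identity representation of \<open>H\<close>, acting on
  \<open>l\<^sup>2(G/H)\<close> by \<open>(U g f)(C) = f (g\<^sup>-\<^sup>1 C)\<close>.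
\<close>

definition induced_trivial ::
    "('g, 'b) monoid_scheme \<Rightarrow> 'g set \<Rightarrow> 'g \<Rightarrow> 'g set operator" where
  "induced_trivial G H g =
     (\<lambda>f\<in>l2 (lcosets\<^bsub>G\<^esub> H). \<lambda>C. if C \<in> lcosets\<^bsub>G\<^esub> H then f (inv\<^bsub>G\<^esub> g <#\<^bsub>G\<^esub> C) else 0)"

section \<open>Basic facts\<close>

lemma l2_add:
  assumes "f \<in> l2 X" "g \<in> l2 X"
  shows "(\<lambda>x. f x + g x) \<in> l2 X"
proof -
  have "(\<lambda>x. 2 * (cmod (f x))\<^sup>2 + 2 * (cmod (g x))\<^sup>2) summable_on X"
    using assms by (intro summable_on_add summable_on_cmult_right) (auto simp: l2_def)
  moreover have "(cmod (f x + g x))\<^sup>2 \<le> 2 * (cmod (f x))\<^sup>2 + 2 * (cmod (g x))\<^sup>2" for x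
  proof -
    have "(cmod (f x + g x))\<^sup>2 \<le> (cmod (f x) + cmod (g x))\<^sup>2"
      by (intro power_mono norm_triangle_ineq) auto
    also have "\<dots> \<le> 2 * (cmod (f x))\<^sup>2 + 2 * (cmod (g x))\<^sup>2"
      using sum_squares_bound[of "cmod (f x)" "cmod (g x)"] by (simp add: power2_sum)
    finally show ?thesis .
  qed
  ultimately have "(\<lambda>x. (cmod (f x + g x))\<^sup>2) summable_on X"
    by (rule summable_on_comparison_test) auto
  then show ?thesis using assms by (auto simp: l2_def)
qed

lemma l2_scale:
  assumes "f \<in> l2 X"
  shows "(\<lambda>x. c * f x) \<in> l2 X"
  using assms by (auto simp: l2_def norm_mult power_mult_distrib intro: summable_on_cmult_right)

lemma (in group) lcosets_translate_bij:
  assumes "subgroup H G" "g \<in> carrier G"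
  shows "bij_betw (\<lambda>C. g <# C) (lcosets H) (lcosets H)"
proof (rule bij_betw_byWitness[where f' = "\<lambda>C. inv g <# C"])
  have sub: "C \<subseteq> carrier G" if "C \<in> lcosets H" for C
    using assms(1) group_axioms that subgroup.lcosets_carrier by blast
  have H: "H \<subseteq> carrier G" using assms(1) subgroup.subset by blast
  show "\<forall>C\<in>lcosets H. inv g <# (g <# C) = C" "\<forall>C\<in>lcosets H. g <# (inv g <# C) = C"
    using sub assms(2) by (simp_all add: lcos_m_assoc lcos_mult_one)
  have tr: "x <# C \<in> lcosets H" if "x \<in> carrier G" "C \<in> lcosets H" for x C
    using that H by (auto simp: LCOSETS_def lcos_m_assoc)
  show "(\<lambda>C. g <# C) ` (lcosets H) \<subseteq> lcosets H" "(\<lambda>C. inv g <# C) ` (lcosets H) \<subseteq> lcosets H"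
    using tr assms(2) by auto
qed

lemma (in group) unitary_rep_induced_trivial:
  assumes H: "subgroup H G"
  shows "unitary_rep G (lcosets H) (induced_trivial G H)"
proof -
  let ?X = "lcosets H" and ?U = "induced_trivial G H"
  have HG: "H \<subseteq> carrier G" using H subgroup.subset by blast
  have sub: "C \<subseteq> carrier G" if "C \<in> ?X" for C
    using H group_axioms that subgroup.lcosets_carrier by blast
  have bij: "bij_betw (\<lambda>C. inv g <# C) ?X ?X" if "g \<in> carrier G" for g
    using lcosets_translate_bij[OF H] that by simp
  have app: "?U g f C = (if C \<in> ?X then f (inv g <# C) else 0)" if "f \<in> l2 ?X" for g f C
    using that by (simp add: induced_trivial_def)
  have mem: "inv g <# C \<in> ?X" if "g \<in> carrier G" "C \<in> ?X" for g C
    using bij[OF that(1)] that(2) by (auto simp: bij_betw_def)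
  have in_l2: "?U g f \<in> l2 ?X" if "g \<in> carrier G" "f \<in> l2 ?X" for g f
  proof -
    have "(\<lambda>C. (cmod (f (inv g <# C)))\<^sup>2) summable_on ?X"
      using summable_on_reindex_bij_betw[OF bij[OF that(1)], of "\<lambda>C. (cmod (f C))\<^sup>2"] that(2)
      by (auto simp: l2_def)
    then have "(\<lambda>C. (cmod (?U g f C))\<^sup>2) summable_on ?X"
      by (rule summable_on_cong[THEN iffD1, rotated]) (simp add: app that)
    then show ?thesis by (simp add: l2_def app[OF that(2)])
  qed
  have norm: "l2_norm ?X (?U g f) = l2_norm ?X f" if "g \<in> carrier G" "f \<in> l2 ?X" for g f
  proof -
    have "(\<Sum>\<^sub>\<infinity>C\<in>?X. (cmod (?U g f C))\<^sup>2) = (\<Sum>\<^sub>\<infinity>C\<in>?X. (cmod (f (inv g <# C)))\<^sup>2)"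
      by (rule infsum_cong) (simp add: app that)
    also have "\<dots> = (\<Sum>\<^sub>\<infinity>C\<in>?X. (cmod (f C))\<^sup>2)"
      by (rule infsum_reindex_bij_betw[OF bij[OF that(1)]])
    finally show ?thesis by (simp add: l2_norm_def)
  qed
  have inner: "l2_inner ?X (?U g f) (?U g f') = l2_inner ?X f f'"
    if "g \<in> carrier G" "f \<in> l2 ?X" "f' \<in> l2 ?X" for g f f'
  proof -
    have "(\<Sum>\<^sub>\<infinity>C\<in>?X. ?U g f C * cnj (?U g f' C)) =
          (\<Sum>\<^sub>\<infinity>C\<in>?X. f (inv g <# C) * cnj (f' (inv g <# C)))"
      by (rule infsum_cong) (simp add: app that)
    also have "\<dots> = (\<Sum>\<^sub>\<infinity>C\<in>?X. f C * cnj (f' C))"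
      by (rule infsum_reindex_bij_betw[OF bij[OF that(1)]])
    finally show ?thesis by (simp add: l2_inner_def)
  qed
  have one: "?U \<one> f = f" if "f \<in> l2 ?X" for f
  proof (rule ext)
    fix C
    have "f C = 0" if "C \<notin> ?X" using \<open>f \<in> l2 ?X\<close> that by (simp add: l2_def)
    then show "?U \<one> f C = f C" by (simp add: app[OF that] lcos_mult_one sub)
  qed
  have mult: "?U (g \<otimes> h) f = ?U g (?U h f)"
    if "g \<in> carrier G" "h \<in> carrier G" "f \<in> l2 ?X" for g h f
  proof (rule ext)
    fix C
    show "?U (g \<otimes> h) f C = ?U g (?U h f) C"
      using that by (simp add: app in_l2 mem inv_mult_group lcos_m_assoc sub)
  qed
  have bdd: "?U g \<in> bounded_ops ?X" if g: "g \<in> carrier G" for g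
    unfolding bounded_ops_def
  proof (intro CollectI conjI ballI allI)
    show "?U g \<in> l2 ?X \<rightarrow>\<^sub>E l2 ?X"
      using in_l2[OF g] by (auto simp: induced_trivial_def PiE_def)
    show "\<exists>C. \<forall>f\<in>l2 ?X. l2_norm ?X (?U g f) \<le> C * l2_norm ?X f"
      using norm[OF g] by (intro exI[of _ 1]) simp
  qed (rule ext, simp add: app l2_add l2_scale)+
  have surj: "?U g ` l2 ?X = l2 ?X" if g: "g \<in> carrier G" for g
  proof (intro equalityI subsetI)
    fix f assume f: "f \<in> l2 ?X"
    have "?U g (?U (inv g) f) = ?U (g \<otimes> inv g) f"
      using f g by (intro mult[symmetric]) auto
    also have "\<dots> = f" using one[OF f] g by simp
    finally show "f \<in> ?U g ` l2 ?X" using in_l2[of "inv g" f] f g by (metis image_eqI inv_closed)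
  qed (use in_l2 g in auto)
  have "?U \<one> = (\<lambda>f\<in>l2 ?X. f)"
  proof (rule ext)
    fix f show "?U \<one> f = (\<lambda>f\<in>l2 ?X. f) f"
      using one[of f] by (cases "f \<in> l2 ?X") (simp_all add: induced_trivial_def)
  qed
  moreover have "?U (g \<otimes> h) = compose (l2 ?X) (?U g) (?U h)"
    if "g \<in> carrier G" "h \<in> carrier G" for g h
  proof (rule ext)
    fix f show "?U (g \<otimes> h) f = compose (l2 ?X) (?U g) (?U h) f"
      using mult[OF that, of f]
      by (cases "f \<in> l2 ?X") (simp_all add: compose_def, simp add: induced_trivial_def)
  qed
  ultimately show ?thesis
    using bdd surj inner by (simp add: unitary_rep_def unitary_ops_def)
qed

lemma mem_sym_group_inf: "p \<in> carrier sym_group_inf \<longleftrightarrow> (\<exists>n. p permutes {1..n})"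
proof
  assume "\<exists>n. p permutes {1..n}"
  then obtain n where n: "p permutes {1..n}" by blast
  have "p permutes {1..Suc n}" by (rule permutes_subset[OF n]) auto
  then show "p \<in> carrier sym_group_inf"
    by (auto simp: sym_group_inf_def sym_group_def intro!: bexI[of _ "Suc n"])
qed (auto simp: sym_group_inf_def sym_group_def)

lemma mem_sym_group_inf':
  "p \<in> carrier sym_group_inf \<longleftrightarrow> p permutes {1..} \<and> finite {x. p x \<noteq> x}"
proof
  assume "p \<in> carrier sym_group_inf"
  then obtain n where n: "p permutes {1..n}" by (auto simp: mem_sym_group_inf)
  then have "{x. p x \<noteq> x} \<subseteq> {1..n}" by (auto simp: permutes_def)
  then show "p permutes {1..} \<and> finite {x. p x \<noteq> x}"
    using n permutes_subset[OF n, of "{1..}"] by (auto intro: finite_subset)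
next
  assume p: "p permutes {1..} \<and> finite {x. p x \<noteq> x}"
  then obtain n where n: "{x. p x \<noteq> x} \<subseteq> {..n}" by (auto simp: finite_nat_iff_bounded_le)
  have "p x = x" if "x \<notin> {1..n}" for x
  proof (cases "x = 0")
    case True then show ?thesis using p by (auto simp: permutes_def)
  next
    case False then show ?thesis using n that by auto
  qed
  then have "p permutes {1..n}" using p by (auto simp: permutes_def)
  then show "p \<in> carrier sym_group_inf" by (auto simp: mem_sym_group_inf)
qed

lemma group_sym_group_inf: "group sym_group_inf"
proof (rule groupI)
  fix p q assume "p \<in> carrier sym_group_inf" "q \<in> carrier sym_group_inf"
  then obtain m n where "p permutes {1..m}" "q permutes {1..n}" by (auto simp: mem_sym_group_inf)
  then have "p permutes {1..max m n}" "q permutes {1..max m n}"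
    by (auto elim!: permutes_subset)
  then show "p \<otimes>\<^bsub>sym_group_inf\<^esub> q \<in> carrier sym_group_inf"
    unfolding mem_sym_group_inf
    by (auto simp: sym_group_inf_def intro!: exI[of _ "max m n"] permutes_compose)
next
  fix p assume "p \<in> carrier sym_group_inf"
  then obtain m where m: "p permutes {1..m}" by (auto simp: mem_sym_group_inf)
  then have "inv' p \<in> carrier sym_group_inf" "inv' p \<circ> p = id"
    by (auto simp: mem_sym_group_inf permutes_inv permutes_inv_o intro!: exI[of _ m])
  then show "\<exists>q\<in>carrier sym_group_inf. q \<otimes>\<^bsub>sym_group_inf\<^esub> p = \<one>\<^bsub>sym_group_inf\<^esub>"
    by (auto simp: sym_group_inf_def)
next
  show "\<one>\<^bsub>sym_group_inf\<^esub> \<in> carrier sym_group_inf"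
    unfolding mem_sym_group_inf by (auto simp: sym_group_inf_def permutes_id)
qed (auto simp: sym_group_inf_def)

lemma subgroup_young_subgroup: "subgroup (young_subgroup P) sym_group_inf"
proof -
  interpret group sym_group_inf by (rule group_sym_group_inf)
  show ?thesis
  proof (rule subgroupI)
    have "\<one>\<^bsub>sym_group_inf\<^esub> \<in> young_subgroup P"
      using one_closed by (simp add: young_subgroup_def) (simp add: sym_group_inf_def)
    then show "young_subgroup P \<noteq> {}" by blast
  next
    fix p assume p: "p \<in> young_subgroup P"
    let ?q = "inv\<^bsub>sym_group_inf\<^esub> p"
    have c: "?q \<in> carrier sym_group_inf" using p by (simp add: young_subgroup_def)
    have "?q \<otimes>\<^bsub>sym_group_inf\<^esub> p = \<one>\<^bsub>sym_group_inf\<^esub>" using p by (simp add: young_subgroup_def)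
    then have "?q \<circ> p = id" by (simp add: sym_group_inf_def)
    have "?q ` A = A" if "A \<in> P" for A
    proof -
      have "p ` A = A" using p that by (simp add: young_subgroup_def)
      then have "?q ` A = (?q \<circ> p) ` A" by (simp only: image_comp[symmetric])
      then show ?thesis by (simp add: \<open>?q \<circ> p = id\<close>)
    qed
    then show "?q \<in> young_subgroup P" using c by (simp add: young_subgroup_def)
  next
    fix p q assume pq: "p \<in> young_subgroup P" "q \<in> young_subgroup P"
    have "(p \<circ> q) ` A = A" if "A \<in> P" for A
      using pq that unfolding image_comp[symmetric] by (simp add: young_subgroup_def)
    moreover have "p \<otimes>\<^bsub>sym_group_inf\<^esub> q \<in> carrier sym_group_inf"
      using pq by (auto simp: young_subgroup_def)
    moreover have "p \<otimes>\<^bsub>sym_group_inf\<^esub> q = p \<circ> q" by (simp add: sym_group_inf_def)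
    ultimately show "p \<otimes>\<^bsub>sym_group_inf\<^esub> q \<in> young_subgroup P"
      by (simp add: young_subgroup_def)
  qed (auto simp: young_subgroup_def)
qed

lemma sum_finite_blocks:
  assumes "partition_of_type P k"
  shows "(\<Sum>i. k (enat (Suc i))) = ecard {A\<in>P. finite A}"
proof -
  let ?F = "{A\<in>P. finite A}"
  let ?L = "\<lambda>n. {A\<in>P. finite A \<and> card A \<le> n}"
  have ne: "{} \<notin> P" using assms by (auto simp: partition_of_type_def partition_on_def)
  have ec_Un: "ecard (A \<union> B) = ecard A + ecard B" if "A \<inter> B = {}" for A B :: "nat set set"
    using that by (auto simp: ecard_def card_Un_disjoint)
  have k: "k (enat (Suc n)) = ecard {A\<in>P. finite A \<and> card A = Suc n}" for n
  proof -
    have "1 \<le> enat (Suc n)" by (simp add: one_enat_def)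
    then have "k (enat (Suc n)) = ecard {A\<in>P. ecard A = enat (Suc n)}"
      using assms unfolding partition_of_type_def by blast
    also have "{A\<in>P. ecard A = enat (Suc n)} = {A\<in>P. finite A \<and> card A = Suc n}"
      by (auto simp: ecard_def split: if_splits)
    finally show ?thesis .
  qed
  have part: "(\<Sum>i<n. k (enat (Suc i))) = ecard (?L n)" for n
  proof (induction n)
    case 0
    have "?L 0 = {}" using ne by (auto simp: card_eq_0_iff)
    then have "ecard (?L 0) = 0" unfolding ecard_def by (simp only:) (simp add: zero_enat_def)
    then show ?case by simp
  next
    case (Suc n)
    have "?L (Suc n) = ?L n \<union> {A\<in>P. finite A \<and> card A = Suc n}" by auto
    then show ?case using Suc by (simp add: k ec_Un disjoint_iff)
  qed
  have mono: "ecard A \<le> ecard B" if "A \<subseteq> B" for A B :: "nat set set"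
    using that by (auto simp: ecard_def card_mono finite_subset)
  have "(\<Sum>i. k (enat (Suc i))) = (SUP n. ecard (?L n))"
    by (subst suminf_eq_SUP) (auto simp: part)
  also have "\<dots> = ecard ?F"
  proof (rule antisym)
    show "(SUP n. ecard (?L n)) \<le> ecard ?F" by (rule SUP_least, rule mono) auto
    have fin: "ecard S \<le> (SUP n. ecard (?L n))" if S: "finite S" "S \<subseteq> ?F" for S
    proof -
      have "S \<subseteq> ?L (Max (card ` S))" using S by auto
      then show ?thesis by (meson SUP_upper2 UNIV_I mono)
    qed
    show "ecard ?F \<le> (SUP n. ecard (?L n))"
    proof (cases "finite ?F")
      case True then show ?thesis using fin by simp
    next
      case False
      have "enat m \<le> (SUP n. ecard (?L n))" for m
      proof -
        obtain S where "finite S" "S \<subseteq> ?F" "card S = m"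
          using infinite_arbitrarily_large[OF False] by blast
        then show ?thesis using fin[of S] by (simp add: ecard_def)
      qed
      then have "(SUP n. ecard (?L n)) \<noteq> enat m" for m
        by (metis Suc_n_not_le_n enat_ord_simps(1))
      then have "(SUP n. ecard (?L n)) = \<infinity>" using not_enat_eq by blast
      then show ?thesis by simp
    qed
  qed
  finally show ?thesis .
qed

end

theory Submission
  imports Defs
    "HOL-Library.Function_Algebras"
    "HOL-Computational_Algebra.Fundamental_Theorem_Algebra"
begin

text \<open>
  Let \<open>G\<close> be a group, \<open>H\<close> a subgroup and \<open>X = G/H\<close>. Two facts govern the representation \<open>U\<close> of \<open>G\<close>
  on \<open>l\<^sup>2(X)\<close>. The vector \<open>\<delta>\<^sub>H\<close> is cyclic and fixed by \<open>H\<close>; hence the orthogonal projection of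
  \<open>\<delta>\<^sub>H\<close> onto a closed invariant subspace \<open>V \<noteq> 0\<close> is a nonzero vector of \<open>V\<close> fixed by \<open>H\<close>
  (\<open>fixed_meets_invariant\<close>). And a square-summable function fixed by \<open>H\<close> is constant on the orbits
  of \<open>H\<close>, so it vanishes on the infinite ones (\<open>fixed_supp\<close>).

  If \<open>{H}\<close> is the only finite orbit, the fixed vectors are the multiples of \<open>\<delta>\<^sub>H\<close>, so every nonzero
  closed invariant subspace contains \<open>\<delta>\<^sub>H\<close> and is everything: \<open>U\<close> is irreducible.
  If finitely many points of \<open>X\<close> lie in finite orbits, the space \<open>E\<close> of fixed vectors is
  finite-dimensional. Splitting a reducible \<open>V\<close> as \<open>W \<oplus> W\<^sup>\<bottom>\<close> strictly decreases the dimension of the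
  intersection with \<open>E\<close> in both summands, so \<open>l\<^sup>2(X)\<close> is a finite orthogonal sum of irreducibles.
  For type I, let \<open>R\<close> be the bicommutant of \<open>U\<close>, which is the von Neumann algebra generated by \<open>U\<close>
  (\<open>von_neumann_generated_eq_bicommutant\<close>), and let \<open>z \<noteq> 0\<close> be a central projection of \<open>R\<close>. Then
  \<open>z \<delta>\<^sub>H \<noteq> 0\<close>, and \<open>z E\<close> is a nonzero finite-dimensional space that is invariant under the commutant
  of \<open>U\<close>. The projection \<open>e\<close> onto a minimal nonzero subspace of \<open>z E\<close> with this
  invariance belongs to \<open>R\<close>. For \<open>S \<in> R\<close> an eigenspace of \<open>e S e\<close> on the range of \<open>e\<close> is again
  invariant under the commutant, so it is the whole range. Thus \<open>e R e\<close> consists of scalar multiples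
  of \<open>e\<close>, and \<open>e \<le> z\<close> is an abelian projection.

  For a Young subgroup, if \<open>g\<close> moves an infinite block \<open>A\<close>, some \<open>a \<in> A\<close> is not in \<open>g A\<close>; the
  transpositions of \<open>a\<close> with the infinitely many points of \<open>A\<close> not moved by \<open>g\<close> lie in the Young
  subgroup and send \<open>g H\<close> to pairwise different cosets. So a finite orbit only contains cosets of
  permutations fixing every infinite block. Such a coset is determined by the images of the finite
  blocks, which are subsets of the union of the finite blocks. This gives the single-orbit condition
  when there is at most one finite block and the finiteness condition when there are finitely many.
  Conversely, if \<open>A \<noteq> B\<close> are finite blocks, merging them gives a Young subgroup \<open>K \<supset> H\<close> in which
  \<open>H\<close> is proper of finite index, and the functions on \<open>G/H\<close> that factor through \<open>G/K\<close> form a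
  nontrivial proper closed invariant subspace (\<open>reducible_if_finite_index_overgroup\<close>).
\<close>

section \<open>Geometry of \<open>l\<^sup>2(X)\<close>\<close>

lemma l2_zero [simp]: "(\<lambda>x. 0) \<in> l2 X"
  by (simp add: l2_def)

lemma l2_diff: "f \<in> l2 X \<Longrightarrow> g \<in> l2 X \<Longrightarrow> (\<lambda>x. f x - g x) \<in> l2 X"
  using l2_add[of f X "\<lambda>x. -1 * g x"] l2_scale[of g X "-1"] by simp

lemma l2_off: "f \<in> l2 X \<Longrightarrow> x \<notin> X \<Longrightarrow> f x = 0"
  by (simp add: l2_def)

lemma l2_sum:
  assumes "\<And>i. i \<in> I \<Longrightarrow> v i \<in> l2 X"
  shows "(\<lambda>x. \<Sum>i\<in>I. v i x) \<in> l2 X"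
  using assms by (induction I rule: infinite_finite_induct) (auto intro: l2_add)

lemma l2_summable: "f \<in> l2 X \<Longrightarrow> (\<lambda>x. (cmod (f x))\<^sup>2) summable_on X"
  by (simp add: l2_def)

lemma l2_norm_nonneg [simp]: "0 \<le> l2_norm X f"
  by (simp add: l2_norm_def infsum_nonneg)

lemma l2_norm_sq: "(l2_norm X f)\<^sup>2 = (\<Sum>\<^sub>\<infinity>x\<in>X. (cmod (f x))\<^sup>2)"
  by (simp add: l2_norm_def infsum_nonneg)

lemma L2_set_le_l2_norm:
  assumes "f \<in> l2 X" "finite F" "F \<subseteq> X"
  shows "L2_set (\<lambda>x. cmod (f x)) F \<le> l2_norm X f"
  unfolding L2_set_def l2_norm_def
  using assms by (auto intro!: finite_sum_le_infsum l2_summable)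

lemma cmod_le_l2_norm:
  assumes "f \<in> l2 X"
  shows "cmod (f x) \<le> l2_norm X f"
proof (cases "x \<in> X")
  case True
  then show ?thesis using L2_set_le_l2_norm[OF assms, of "{x}"] by (simp add: L2_set_def)
qed (simp add: l2_off[OF assms])

lemma l2_norm_zero [simp]: "l2_norm X (\<lambda>x. 0) = 0"
  by (simp add: l2_norm_def)

lemma l2_norm_eq_0: "f \<in> l2 X \<Longrightarrow> l2_norm X f = 0 \<Longrightarrow> f = (\<lambda>x. 0)"
  using cmod_le_l2_norm[of f X] by (auto simp: fun_eq_iff)

text \<open>
  Membership in \<open>l\<^sup>2(X)\<close> and a bound on the norm can both be read off the finite partial sums.
\<close>
lemma l2_boundedI:
  assumes off: "\<And>x. x \<notin> X \<Longrightarrow> f x = 0" and "0 \<le> B"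
    and le: "\<And>F. finite F \<Longrightarrow> F \<subseteq> X \<Longrightarrow> L2_set (\<lambda>x. cmod (f x)) F \<le> B"
  shows "f \<in> l2 X \<and> l2_norm X f \<le> B"
proof -
  have le2: "(\<Sum>x\<in>F. (cmod (f x))\<^sup>2) \<le> B\<^sup>2" if "finite F" "F \<subseteq> X" for F
    using le[OF that] unfolding L2_set_def by (rule sqrt_le_D)
  have s: "(\<lambda>x. (cmod (f x))\<^sup>2) summable_on X"
    by (rule nonneg_bdd_above_summable_on) (auto intro!: bdd_aboveI2[where M = "B\<^sup>2"] le2)
  have "(\<Sum>\<^sub>\<infinity>x\<in>X. (cmod (f x))\<^sup>2) \<le> B\<^sup>2"
    by (rule infsum_le_finite_sums[OF s]) (auto intro: le2)
  then show ?thesis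
    using s off \<open>0 \<le> B\<close> by (auto simp: l2_def l2_norm_def intro: real_le_lsqrt infsum_nonneg)
qed

lemma l2_norm_triangle:
  assumes "f \<in> l2 X" "g \<in> l2 X"
  shows "l2_norm X (\<lambda>x. f x + g x) \<le> l2_norm X f + l2_norm X g"
proof -
  have "L2_set (\<lambda>x. cmod (f x + g x)) F \<le> l2_norm X f + l2_norm X g"
    if F: "finite F" "F \<subseteq> X" for F
  proof -
    have "L2_set (\<lambda>x. cmod (f x + g x)) F \<le> L2_set (\<lambda>x. cmod (f x) + cmod (g x)) F"
      by (rule L2_set_mono) (auto intro: norm_triangle_ineq)
    also have "\<dots> \<le> L2_set (\<lambda>x. cmod (f x)) F + L2_set (\<lambda>x. cmod (g x)) F"
      by (rule L2_set_triangle_ineq)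
    also have "\<dots> \<le> l2_norm X f + l2_norm X g"
      by (intro add_mono L2_set_le_l2_norm assms F)
    finally show ?thesis .
  qed
  then have "(\<lambda>x. f x + g x) \<in> l2 X \<and> l2_norm X (\<lambda>x. f x + g x) \<le> l2_norm X f + l2_norm X g"
    by (intro l2_boundedI) (auto simp: assms l2_off[OF assms(1)] l2_off[OF assms(2)])
  then show ?thesis ..
qed

lemma l2_norm_scale: "l2_norm X (\<lambda>x. c * f x) = cmod c * l2_norm X f"
  by (simp add: l2_norm_def norm_mult power_mult_distrib infsum_cmult_right' real_sqrt_mult)

lemma l2_norm_diff_triangle:
  assumes "f \<in> l2 X" "g \<in> l2 X" "h \<in> l2 X"
  shows "l2_norm X (\<lambda>x. f x - h x) \<le> l2_norm X (\<lambda>x. f x - g x) + l2_norm X (\<lambda>x. g x - h x)"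
  using l2_norm_triangle[OF l2_diff[OF assms(1,2)] l2_diff[OF assms(2,3)]] by simp

lemma l2_inner_summable:
  assumes "f \<in> l2 X" "g \<in> l2 X"
  shows "(\<lambda>x. cmod (f x * cnj (g x))) summable_on X"
proof (rule summable_on_comparison_test)
  show "(\<lambda>x. (cmod (f x))\<^sup>2 + (cmod (g x))\<^sup>2) summable_on X"
    using assms by (intro summable_on_add l2_summable)
  fix x
  have "0 \<le> cmod (f x) * cmod (g x)" by simp
  then show "cmod (f x * cnj (g x)) \<le> (cmod (f x))\<^sup>2 + (cmod (g x))\<^sup>2"
    using sum_squares_bound[of "cmod (f x)" "cmod (g x)"] unfolding norm_mult complex_mod_cnj
    by linarith
qed auto

lemma Cauchy_Schwarz_l2:
  assumes "f \<in> l2 X" "g \<in> l2 X"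
  shows "cmod (l2_inner X f g) \<le> l2_norm X f * l2_norm X g"
proof -
  note s = l2_inner_summable[OF assms]
  have "cmod (l2_inner X f g) \<le> (\<Sum>\<^sub>\<infinity>x\<in>X. cmod (f x * cnj (g x)))"
    unfolding l2_inner_def by (rule norm_infsum_bound) (use s in auto)
  also have "\<dots> \<le> l2_norm X f * l2_norm X g"
  proof (rule infsum_le_finite_sums[OF s])
    fix F assume F: "finite F" "F \<subseteq> X"
    have "(\<Sum>x\<in>F. cmod (f x * cnj (g x))) = (\<Sum>x\<in>F. \<bar>cmod (f x)\<bar> * \<bar>cmod (g x)\<bar>)"
      by (simp add: norm_mult)
    also have "\<dots> \<le> L2_set (\<lambda>x. cmod (f x)) F * L2_set (\<lambda>x. cmod (g x)) F"
      by (rule L2_set_mult_ineq)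
    also have "\<dots> \<le> l2_norm X f * l2_norm X g"
      by (intro mult_mono L2_set_le_l2_norm assms F L2_set_nonneg l2_norm_nonneg)
    finally show "(\<Sum>x\<in>F. cmod (f x * cnj (g x))) \<le> l2_norm X f * l2_norm X g" .
  qed
  finally show ?thesis .
qed

lemma l2_inner_summable':
  assumes "f \<in> l2 X" "g \<in> l2 X"
  shows "(\<lambda>x. f x * cnj (g x)) summable_on X"
  by (rule abs_summable_summable) (rule l2_inner_summable[OF assms])

lemma l2_inner_add_left:
  assumes "f \<in> l2 X" "g \<in> l2 X" "h \<in> l2 X"
  shows "l2_inner X (\<lambda>x. f x + g x) h = l2_inner X f h + l2_inner X g h"
  by (simp add: l2_inner_def distrib_right infsum_add l2_inner_summable' assms)

lemma l2_inner_scale_left: "l2_inner X (\<lambda>x. c * f x) h = c * l2_inner X f h"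
  by (simp add: l2_inner_def mult.assoc infsum_cmult_right')

lemma l2_inner_commute: "l2_inner X f g = cnj (l2_inner X g f)"
  by (simp add: l2_inner_def mult.commute flip: infsum_cnj)

lemma l2_inner_add_right:
  assumes "f \<in> l2 X" "g \<in> l2 X" "h \<in> l2 X"
  shows "l2_inner X h (\<lambda>x. f x + g x) = l2_inner X h f + l2_inner X h g"
  using l2_inner_add_left[OF assms] by (metis l2_inner_commute complex_cnj_add)

lemma l2_inner_scale_right: "l2_inner X h (\<lambda>x. c * f x) = cnj c * l2_inner X h f"
  by (metis l2_inner_commute complex_cnj_mult l2_inner_scale_left)

lemma l2_inner_diff_left:
  assumes "f \<in> l2 X" "g \<in> l2 X" "h \<in> l2 X"
  shows "l2_inner X (\<lambda>x. f x - g x) h = l2_inner X f h - l2_inner X g h"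
  using l2_inner_add_left[OF assms(1) l2_scale[OF assms(2), of "-1"] assms(3)]
    l2_inner_scale_left[of X "-1" g h] by simp

lemma l2_inner_diff_right:
  assumes "f \<in> l2 X" "g \<in> l2 X" "h \<in> l2 X"
  shows "l2_inner X h (\<lambda>x. f x - g x) = l2_inner X h f - l2_inner X h g"
  using l2_inner_diff_left[OF assms] by (metis l2_inner_commute complex_cnj_diff)

lemma l2_inner_zero [simp]: "l2_inner X (\<lambda>x. 0) f = 0" "l2_inner X f (\<lambda>x. 0) = 0"
  by (simp_all add: l2_inner_def)

lemma l2_inner_self:
  assumes "f \<in> l2 X"
  shows "l2_inner X f f = of_real ((l2_norm X f)\<^sup>2)"
proof -
  have "l2_inner X f f = (\<Sum>\<^sub>\<infinity>x\<in>X. of_real ((cmod (f x))\<^sup>2))"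
    by (simp only: l2_inner_def complex_norm_square)
  also have "\<dots> = of_real ((l2_norm X f)\<^sup>2)"
    unfolding l2_norm_sq
    by (intro infsumI has_sum_of_real has_sum_infsum l2_summable[OF assms])
  finally show ?thesis .
qed

lemma l2_inner_self_eq_0: "f \<in> l2 X \<Longrightarrow> l2_inner X f f = 0 \<Longrightarrow> f = (\<lambda>x. 0)"
  by (simp add: l2_inner_self l2_norm_eq_0)

lemma l2_norm_diff_sq:
  assumes "f \<in> l2 X" "g \<in> l2 X"
  shows "(l2_norm X (\<lambda>x. f x - c * g x))\<^sup>2 =
         (l2_norm X f)\<^sup>2 - 2 * Re (cnj c * l2_inner X f g) + (cmod c)\<^sup>2 * (l2_norm X g)\<^sup>2"
proof -
  let ?h = "\<lambda>x. c * g x"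
  note h = l2_scale[OF assms(2), of c]
  have "of_real ((l2_norm X (\<lambda>x. f x - ?h x))\<^sup>2) =
      l2_inner X f f - l2_inner X f ?h - l2_inner X ?h f + l2_inner X ?h ?h"
    by (simp only: l2_inner_diff_left l2_inner_diff_right l2_diff assms h
        flip: l2_inner_self[OF l2_diff[OF assms(1) h]]) (simp only: algebra_simps)
  also have "l2_inner X ?h f = cnj (l2_inner X f ?h)" by (rule l2_inner_commute)
  also have "l2_inner X f f - l2_inner X f ?h - cnj (l2_inner X f ?h) + l2_inner X ?h ?h =
     of_real ((l2_norm X f)\<^sup>2 - 2 * Re (l2_inner X f ?h) + (l2_norm X ?h)\<^sup>2)"
    by (simp add: l2_inner_self assms h complex_eq_iff)
  finally show ?thesis
    by (simp only: of_real_eq_iff l2_inner_scale_right l2_norm_scale power_mult_distrib)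
qed

lemma parallelogram_l2:
  assumes "f \<in> l2 X" "g \<in> l2 X"
  shows "(l2_norm X (\<lambda>x. f x + g x))\<^sup>2 + (l2_norm X (\<lambda>x. f x - g x))\<^sup>2 =
         2 * (l2_norm X f)\<^sup>2 + 2 * (l2_norm X g)\<^sup>2"
  using l2_norm_diff_sq[OF assms, of 1] l2_norm_diff_sq[OF assms, of "-1"] by simp

lemma l2_inner_tendsto:
  assumes "\<And>n. s n \<in> l2 X" "f \<in> l2 X" "g \<in> l2 X"
    and "(\<lambda>n. l2_norm X (\<lambda>x. s n x - f x)) \<longlonglongrightarrow> 0"
  shows "(\<lambda>n. l2_inner X (s n) g) \<longlonglongrightarrow> l2_inner X f g"
proof -
  have z: "(\<lambda>n. l2_norm X (\<lambda>x. s n x - f x) * l2_norm X g) \<longlonglongrightarrow> 0"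
    using tendsto_mult[OF assms(4) tendsto_const[of "l2_norm X g"]] by simp
  have "cmod (l2_inner X (s n) g - l2_inner X f g)
      \<le> l2_norm X (\<lambda>x. s n x - f x) * l2_norm X g" for n
    using Cauchy_Schwarz_l2[OF l2_diff[OF assms(1,2)] assms(3), of n]
    by (simp only: l2_inner_diff_left assms)
  then have "(\<lambda>n. l2_inner X (s n) g - l2_inner X f g) \<longlonglongrightarrow> 0"
    by (intro Lim_null_comparison[OF _ z] always_eventually allI)
  then show ?thesis by (simp add: LIM_zero_iff)
qed

lemma l2_limit_unique:
  assumes "\<And>n. s n \<in> l2 X" "f \<in> l2 X" "g \<in> l2 X"
    and "(\<lambda>n. l2_norm X (\<lambda>x. s n x - f x)) \<longlonglongrightarrow> 0" "(\<lambda>n. l2_norm X (\<lambda>x. s n x - g x)) \<longlonglongrightarrow> 0"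
  shows "f = g"
proof -
  have "l2_inner X f h = l2_inner X g h" if "h \<in> l2 X" for h
    using l2_inner_tendsto[OF assms(1,2) that assms(4)] l2_inner_tendsto[OF assms(1,3) that assms(5)]
    by (rule LIMSEQ_unique)
  then have "(\<lambda>x. f x - g x) = (\<lambda>x. 0)"
    by (intro l2_inner_self_eq_0[of _ X]) (simp_all add: l2_inner_diff_left assms l2_diff)
  then show ?thesis by (simp add: fun_eq_iff)
qed

text \<open>
  Completeness of \<open>l\<^sup>2(X)\<close>: the limit is taken pointwise, and the bound on finite partial sums
  survives the passage to the limit.
\<close>
lemma l2_complete:
  fixes s :: "nat \<Rightarrow> 'x \<Rightarrow> complex" and X :: "'x set"
  assumes s: "\<And>n. s n \<in> l2 X"
    and cauchy: "\<And>e. e > 0 \<Longrightarrow> \<exists>N. \<forall>m\<ge>N. \<forall>n\<ge>N. l2_norm X (\<lambda>x. s m x - s n x) \<le> e"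
  shows "\<exists>f\<in>l2 X. (\<lambda>n. l2_norm X (\<lambda>x. s n x - f x)) \<longlonglongrightarrow> 0"
proof -
  have "Cauchy (\<lambda>n. s n x)" for x
  proof (rule metric_CauchyI)
    fix e :: real assume "e > 0"
    then obtain N where N: "\<forall>m\<ge>N. \<forall>n\<ge>N. l2_norm X (\<lambda>x. s m x - s n x) \<le> e / 2"
      using cauchy[of "e/2"] by auto
    have "dist (s m x) (s n x) < e" if "m \<ge> N" "n \<ge> N" for m n
    proof -
      have "l2_norm X (\<lambda>x. s m x - s n x) \<le> e / 2" using N that by blast
      then show ?thesis
        using cmod_le_l2_norm[OF l2_diff[OF s[of m] s[of n]], of x] \<open>e > 0\<close> by (simp add: dist_norm)
    qed
    then show "\<exists>N. \<forall>m\<ge>N. \<forall>n\<ge>N. dist (s m x) (s n x) < e" by blast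
  qed
  then have "\<exists>l. (\<lambda>n. s n x) \<longlonglongrightarrow> l" for x
    using Cauchy_convergent convergent_def by blast
  then obtain f where f: "\<And>x. (\<lambda>n. s n x) \<longlonglongrightarrow> f x" by metis
  have fo: "f x = 0" if "x \<notin> X" for x
    using f[of x] by (simp add: l2_off[OF s that] LIMSEQ_const_iff)
  have tail: "\<exists>N. \<forall>n\<ge>N. (\<lambda>x. s n x - f x) \<in> l2 X \<and> l2_norm X (\<lambda>x. s n x - f x) \<le> e"
    if "e > 0" for e
  proof -
    obtain N where N: "\<And>m n. m \<ge> N \<Longrightarrow> n \<ge> N \<Longrightarrow> l2_norm X (\<lambda>x. s m x - s n x) \<le> e"
      using cauchy[OF \<open>e > 0\<close>] by blast
    have "(\<lambda>x. s n x - f x) \<in> l2 X \<and> l2_norm X (\<lambda>x. s n x - f x) \<le> e" if "n \<ge> N" for n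
    proof (rule l2_boundedI)
      fix F assume F: "finite F" "F \<subseteq> X"
      have "(\<lambda>m. L2_set (\<lambda>x. cmod (s n x - s m x)) F) \<longlonglongrightarrow> L2_set (\<lambda>x. cmod (s n x - f x)) F"
        unfolding L2_set_def by (intro tendsto_intros f)
      moreover have "L2_set (\<lambda>x. cmod (s n x - s m x)) F \<le> e" if "m \<ge> N" for m
        using L2_set_le_l2_norm[OF l2_diff[OF s[of n] s[of m]] F] N[OF \<open>n \<ge> N\<close> that] by linarith
      ultimately show "L2_set (\<lambda>x. cmod (s n x - f x)) F \<le> e"
        by (intro LIMSEQ_le_const2) auto
    qed (use \<open>e > 0\<close> in \<open>auto simp: fo l2_off[OF s]\<close>)
    then show ?thesis by blast
  qed
  obtain N where "(\<lambda>x. s N x - f x) \<in> l2 X" using tail[of 1] by auto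
  then have "f \<in> l2 X" using l2_diff[OF s, of "\<lambda>x. s N x - f x" N] by simp
  moreover have "(\<lambda>n. l2_norm X (\<lambda>x. s n x - f x)) \<longlonglongrightarrow> 0"
  proof (rule metric_LIMSEQ_I)
    fix e :: real assume "e > 0"
    then obtain N where N: "\<forall>n\<ge>N. (\<lambda>x. s n x - f x) \<in> l2 X \<and> l2_norm X (\<lambda>x. s n x - f x) \<le> e / 2"
      using tail[of "e / 2"] by auto
    have "dist (l2_norm X (\<lambda>x. s n x - f x)) 0 < e" if "n \<ge> N" for n
    proof -
      have "l2_norm X (\<lambda>x. s n x - f x) \<le> e / 2" using N that by blast
      then show ?thesis using \<open>e > 0\<close> by (simp add: dist_norm)
    qed
    then show "\<exists>N. \<forall>n\<ge>N. dist (l2_norm X (\<lambda>x. s n x - f x)) 0 < e" by blast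
  qed
  ultimately show ?thesis by blast
qed

section \<open>Closed subspaces and orthogonal projections\<close>

lemma closed_subspaceD:
  assumes "closed_subspace X V"
  shows "f \<in> V \<Longrightarrow> f \<in> l2 X" "(\<lambda>x. 0) \<in> V"
    "f \<in> V \<Longrightarrow> g \<in> V \<Longrightarrow> (\<lambda>x. f x + g x) \<in> V" "f \<in> V \<Longrightarrow> (\<lambda>x. c * f x) \<in> V"
    "\<lbrakk>\<And>n. s n \<in> V; f \<in> l2 X; (\<lambda>n. l2_norm X (\<lambda>x. s n x - f x)) \<longlonglongrightarrow> 0\<rbrakk> \<Longrightarrow> f \<in> V"
  using assms unfolding closed_subspace_def by blast+

lemma closed_subspace_diff:
  "closed_subspace X V \<Longrightarrow> f \<in> V \<Longrightarrow> g \<in> V \<Longrightarrow> (\<lambda>x. f x - g x) \<in> V"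
  using closed_subspaceD(3)[of X V f "\<lambda>x. -1 * g x"] closed_subspaceD(4)[of X V g "-1"] by simp

lemma closed_subspace_sum:
  assumes "closed_subspace X V" "\<And>i. i \<in> I \<Longrightarrow> v i \<in> V"
  shows "(\<lambda>x. \<Sum>i\<in>I. v i x) \<in> V"
  using assms(2)
  by (induction I rule: infinite_finite_induct) (auto intro: closed_subspaceD[OF assms(1)])

lemma closed_subspace_l2: "closed_subspace X (l2 X)"
  by (auto simp: closed_subspace_def l2_add l2_scale)

lemma closed_subspace_Int:
  "closed_subspace X V \<Longrightarrow> closed_subspace X W \<Longrightarrow> closed_subspace X (V \<inter> W)"
  unfolding closed_subspace_def by blast

lemma closed_subspace_orthogonal:
  assumes V: "closed_subspace X V" and W: "W \<subseteq> l2 X"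
  shows "closed_subspace X {f\<in>V. \<forall>g\<in>W. l2_inner X f g = 0}"
  unfolding closed_subspace_def
proof (intro conjI allI impI ballI)
  fix s f assume s: "(\<forall>n::nat. s n \<in> {f\<in>V. \<forall>g\<in>W. l2_inner X f g = 0}) \<and> f \<in> l2 X \<and>
    (\<lambda>n. l2_norm X (\<lambda>x. s n x - f x)) \<longlonglongrightarrow> 0"
  have "l2_inner X f g = 0" if "g \<in> W" for g
  proof -
    have "(\<lambda>n. l2_inner X (s n) g) \<longlonglongrightarrow> l2_inner X f g"
      using s that W closed_subspaceD(1)[OF V] by (intro l2_inner_tendsto) auto
    then show ?thesis using s that by (simp add: LIMSEQ_const_iff)
  qed
  then show "f \<in> {f\<in>V. \<forall>g\<in>W. l2_inner X f g = 0}"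
    using s closed_subspaceD(5)[OF V, of s f] by auto
next
  fix f g assume "f \<in> {f\<in>V. \<forall>g\<in>W. l2_inner X f g = 0}" "g \<in> {f\<in>V. \<forall>g\<in>W. l2_inner X f g = 0}"
  then have fg: "f \<in> V" "g \<in> V" and 0: "\<And>h. h \<in> W \<Longrightarrow> l2_inner X f h = 0 \<and> l2_inner X g h = 0"
    by auto
  have "l2_inner X (\<lambda>x. f x + g x) h = 0" if "h \<in> W" for h
    using 0[OF that] that fg
    by (subst l2_inner_add_left) (auto intro: closed_subspaceD(1)[OF V] subsetD[OF W])
  then show "(\<lambda>x. f x + g x) \<in> {f\<in>V. \<forall>g\<in>W. l2_inner X f g = 0}"
    using closed_subspaceD(3)[OF V fg] by blast
next
  fix c f assume "f \<in> {f\<in>V. \<forall>g\<in>W. l2_inner X f g = 0}"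
  then show "(\<lambda>x. c * f x) \<in> {f\<in>V. \<forall>g\<in>W. l2_inner X f g = 0}"
    using closed_subspaceD(4)[OF V] by (auto simp: l2_inner_scale_left)
qed (use closed_subspaceD(1,2)[OF V] in auto)

theorem orthogonal_projection_exists:
  assumes V: "closed_subspace X V" and f: "f \<in> l2 X"
  shows "\<exists>p\<in>V. \<forall>g\<in>V. l2_inner X (\<lambda>x. f x - p x) g = 0"
proof -
  note Vl2 = closed_subspaceD(1)[OF V]
  define D where "D v = (l2_norm X (\<lambda>x. f x - v x))\<^sup>2" for v
  define d where "d = (INF v\<in>V. D v)"
  have bdd: "bdd_below (D ` V)" by (rule bdd_belowI[of _ 0]) (auto simp: D_def)
  have d_le: "d \<le> D v" if "v \<in> V" for v unfolding d_def by (rule cINF_lower[OF bdd that])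
  have "\<exists>v\<in>V. D v < d + 1 / Suc n" for n
  proof -
    have "d < d + 1 / Suc n" by simp
    moreover have "V \<noteq> {}" using closed_subspaceD(2)[OF V] by blast
    ultimately show ?thesis unfolding d_def by (subst (asm) cINF_less_iff) (use bdd in auto)
  qed
  then obtain s where sV: "\<And>n. s n \<in> V" and sd: "\<And>n. D (s n) < d + 1 / Suc n" by metis
  note sl2 = Vl2[OF sV]
  \<comment> \<open>A minimizing sequence is Cauchy, by the parallelogram law applied to \<open>f - s n\<close> and \<open>f - s m\<close>.\<close>
  have near: "(l2_norm X (\<lambda>x. s m x - s n x))\<^sup>2 \<le> 2 / Suc m + 2 / Suc n" for m n
  proof -
    let ?a = "\<lambda>x. f x - s n x" and ?b = "\<lambda>x. f x - s m x"
    let ?mid = "\<lambda>x. (1/2) * (s n x + s m x)"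
    have mid: "?mid \<in> V" by (rule closed_subspaceD(4)[OF V closed_subspaceD(3)[OF V sV sV]])
    have "(\<lambda>x. ?a x + ?b x) = (\<lambda>x. 2 * (f x - ?mid x))" by (simp add: fun_eq_iff field_simps)
    then have "l2_norm X (\<lambda>x. ?a x + ?b x) = 2 * l2_norm X (\<lambda>x. f x - ?mid x)"
      using l2_norm_scale[of X 2 "\<lambda>x. f x - ?mid x"] by simp
    then have "(l2_norm X (\<lambda>x. ?a x + ?b x))\<^sup>2 = 4 * D ?mid"
      by (simp add: D_def power_mult_distrib)
    moreover have "(\<lambda>x. ?a x - ?b x) = (\<lambda>x. s m x - s n x)" by (simp add: fun_eq_iff)
    ultimately have "4 * D ?mid + (l2_norm X (\<lambda>x. s m x - s n x))\<^sup>2 = 2 * D (s n) + 2 * D (s m)"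
      using parallelogram_l2[OF l2_diff[OF f sl2] l2_diff[OF f sl2], of n m]
      unfolding D_def by (simp only:)
    then show ?thesis using d_le[OF mid] sd[of n] sd[of m] by simp
  qed
  have "\<exists>p\<in>l2 X. (\<lambda>n. l2_norm X (\<lambda>x. s n x - p x)) \<longlonglongrightarrow> 0"
  proof (rule l2_complete[OF sl2])
    fix e :: real assume e: "e > 0"
    obtain N where "4 / e\<^sup>2 < real N" using reals_Archimedean2 by blast
    then have N: "4 / e\<^sup>2 < real (Suc N)" by simp
    have "l2_norm X (\<lambda>x. s m x - s n x) \<le> e" if "m \<ge> N" "n \<ge> N" for m n
    proof -
      have "2 / real (Suc k) \<le> e\<^sup>2 / 2" if "k \<ge> N" for k
      proof -
        have "2 / real (Suc k) \<le> 2 / real (Suc N)" using that by (intro divide_left_mono) auto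
        also have "\<dots> \<le> e\<^sup>2 / 2" using N e by (simp add: field_simps)
        finally show ?thesis .
      qed
      from this[OF that(1)] this[OF that(2)] have "(l2_norm X (\<lambda>x. s m x - s n x))\<^sup>2 \<le> e\<^sup>2"
        using near[of m n] by linarith
      then show ?thesis using e by (auto dest: power2_le_imp_le)
    qed
    then show "\<exists>N. \<forall>m\<ge>N. \<forall>n\<ge>N. l2_norm X (\<lambda>x. s m x - s n x) \<le> e" by blast
  qed
  then obtain p where p: "p \<in> l2 X" and lim: "(\<lambda>n. l2_norm X (\<lambda>x. s n x - p x)) \<longlonglongrightarrow> 0" by blast
  have pV: "p \<in> V" using closed_subspaceD(5)[OF V sV p lim] .
  have "sqrt (D p) \<le> sqrt d"
  proof (rule LIMSEQ_le_const)
    have "(\<lambda>n. sqrt (d + 1 / Suc n)) \<longlonglongrightarrow> sqrt (d + 0)"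
      using LIMSEQ_inverse_real_of_nat by (intro tendsto_intros) (simp add: inverse_eq_divide)
    then show "(\<lambda>n. sqrt (d + 1 / Suc n) + l2_norm X (\<lambda>x. s n x - p x)) \<longlonglongrightarrow> sqrt d"
      using tendsto_add[OF _ lim] by fastforce
    show "\<exists>N. \<forall>n\<ge>N. sqrt (D p) \<le> sqrt (d + 1 / Suc n) + l2_norm X (\<lambda>x. s n x - p x)"
    proof (intro exI allI impI)
      fix n
      have "l2_norm X (\<lambda>x. f x - s n x) \<le> sqrt (d + 1 / Suc n)"
        using sd[of n] unfolding D_def by (intro real_le_rsqrt) simp
      then show "sqrt (D p) \<le> sqrt (d + 1 / Suc n) + l2_norm X (\<lambda>x. s n x - p x)"
        using l2_norm_diff_triangle[OF f sl2 p, of n] by (simp add: D_def)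
    qed
  qed
  then have dp: "D p \<le> d" by simp
  have "l2_inner X (\<lambda>x. f x - p x) g = 0" if g: "g \<in> V" for g
  proof (rule ccontr)
    let ?h = "\<lambda>x. f x - p x"
    assume i0: "l2_inner X ?h g \<noteq> 0"
    have h: "?h \<in> l2 X" by (rule l2_diff[OF f p])
    have n0: "l2_norm X g \<noteq> 0"
      using Cauchy_Schwarz_l2[OF h Vl2[OF g]] i0 by auto
    \<comment> \<open>For this \<open>c\<close>, the point \<open>p + c g\<close> of \<open>V\<close> is closer to \<open>f\<close> than \<open>p\<close>.\<close>
    define c where "c = l2_inner X ?h g / of_real ((l2_norm X g)\<^sup>2)"
    have "D (\<lambda>x. p x + c * g x) = (l2_norm X (\<lambda>x. ?h x - c * g x))\<^sup>2"
      by (simp add: D_def algebra_simps)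
    also have "\<dots> = D p - 2 * Re (cnj c * l2_inner X ?h g) + (cmod c)\<^sup>2 * (l2_norm X g)\<^sup>2"
      using l2_norm_diff_sq[OF h Vl2[OF g], of c] by (simp add: D_def)
    also have "cnj c * l2_inner X ?h g = of_real ((cmod c)\<^sup>2 * (l2_norm X g)\<^sup>2)"
      unfolding of_real_mult complex_norm_square using n0 by (simp add: c_def field_simps)
    finally have "D (\<lambda>x. p x + c * g x) = D p - (cmod c)\<^sup>2 * (l2_norm X g)\<^sup>2"
      by (simp only: Re_complex_of_real)
    moreover have "(cmod c)\<^sup>2 * (l2_norm X g)\<^sup>2 > 0" using n0 i0 by (simp add: c_def)
    moreover have "d \<le> D (\<lambda>x. p x + c * g x)"
      by (intro d_le closed_subspaceD(3)[OF V pV] closed_subspaceD(4)[OF V g])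
    ultimately show False using dp by linarith
  qed
  then show ?thesis using pV by blast
qed

section \<open>The standard basis\<close>

lemma l2_eqI:
  assumes "f \<in> l2 X" "g \<in> l2 X" "\<And>h. h \<in> l2 X \<Longrightarrow> l2_inner X f h = l2_inner X g h"
  shows "f = g"
proof -
  have "(\<lambda>x. f x - g x) = (\<lambda>x. 0)"
    using assms by (intro l2_inner_self_eq_0[of _ X]) (simp_all add: l2_inner_diff_left l2_diff)
  then show ?thesis by (simp add: fun_eq_iff)
qed

lemma l2_eqI':
  assumes "f \<in> l2 X" "g \<in> l2 X" "\<And>h. h \<in> l2 X \<Longrightarrow> l2_inner X h f = l2_inner X h g"
  shows "f = g"
  using assms(3) by (intro l2_eqI[OF assms(1,2)]) (metis l2_inner_commute)

text \<open>
  The standard basis vector at \<open>y\<close>; it belongs to \<open>l\<^sup>2(X)\<close> only when \<open>y \<in> X\<close>.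
\<close>
definition delta :: "'x \<Rightarrow> 'x \<Rightarrow> complex" where
  "delta y = (\<lambda>x. of_bool (x = y))"

lemma delta_l2: "y \<in> X \<Longrightarrow> delta y \<in> l2 X"
proof -
  assume y: "y \<in> X"
  have "(\<lambda>x. (cmod (delta y x))\<^sup>2) summable_on X \<longleftrightarrow> (\<lambda>x. (cmod (delta y x))\<^sup>2) summable_on {y}"
    using y by (intro summable_on_cong_neutral) (auto simp: delta_def)
  then show ?thesis using y by (auto simp: l2_def delta_def)
qed

lemma l2_inner_delta:
  assumes "y \<in> X"
  shows "l2_inner X f (delta y) = f y"
proof -
  have "l2_inner X f (delta y) = (\<Sum>\<^sub>\<infinity>x\<in>{y}. f x * cnj (delta y x))"
    unfolding l2_inner_def using assms by (intro infsum_cong_neutral) (auto simp: delta_def)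
  then show ?thesis by (simp add: delta_def)
qed

lemma delta_neq_0: "delta y \<noteq> (\<lambda>x. 0)"
  by (auto simp: delta_def fun_eq_iff intro: exI[of _ y])

text \<open>
  The standard basis vectors span a dense subspace.
\<close>
lemma closed_subspace_eq_l2I:
  assumes V: "closed_subspace X V" and d: "\<And>y. y \<in> X \<Longrightarrow> delta y \<in> V"
  shows "V = l2 X"
proof (intro equalityI subsetI)
  fix f assume f: "f \<in> l2 X"
  obtain p where p: "p \<in> V" "\<And>g. g \<in> V \<Longrightarrow> l2_inner X (\<lambda>x. f x - p x) g = 0"
    using orthogonal_projection_exists[OF V f] by blast
  have "f x = p x" for x
  proof (cases "x \<in> X")
    case True then show ?thesis using p(2)[OF d[OF True]] by (simp add: l2_inner_delta)
  next
    case False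
    then show ?thesis using l2_off[OF f] l2_off[OF closed_subspaceD(1)[OF V p(1)]] by simp
  qed
  then have "f = p" by blast
  then show "f \<in> V" using p(1) by simp
qed (rule closed_subspaceD(1)[OF V])

section \<open>Bounded operators and their adjoints\<close>

lemma bounded_opsD:
  assumes "T \<in> bounded_ops X"
  shows "f \<in> l2 X \<Longrightarrow> T f \<in> l2 X"
    "f \<in> l2 X \<Longrightarrow> g \<in> l2 X \<Longrightarrow> T (\<lambda>x. f x + g x) = (\<lambda>x. T f x + T g x)"
    "f \<in> l2 X \<Longrightarrow> T (\<lambda>x. c * f x) = (\<lambda>x. c * T f x)"
    "f \<notin> l2 X \<Longrightarrow> T f = undefined"
  using assms by (auto simp: bounded_ops_def)

lemma bounded_op_diff:
  assumes "T \<in> bounded_ops X" "f \<in> l2 X" "g \<in> l2 X"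
  shows "T (\<lambda>x. f x - g x) = (\<lambda>x. T f x - T g x)"
  using bounded_opsD(2)[OF assms(1,2) l2_scale[OF assms(3), of "-1"]]
    bounded_opsD(3)[OF assms(1,3), of "-1"] by simp

lemma bounded_op_zero: "T \<in> bounded_ops X \<Longrightarrow> T (\<lambda>x. 0) = (\<lambda>x. 0)"
  using bounded_opsD(3)[of T X "\<lambda>x. 0" 0] by simp

lemma bounded_op_bound:
  assumes "T \<in> bounded_ops X"
  obtains C where "C \<ge> 0" "\<And>f. f \<in> l2 X \<Longrightarrow> l2_norm X (T f) \<le> C * l2_norm X f"
proof -
  obtain C where C: "\<And>f. f \<in> l2 X \<Longrightarrow> l2_norm X (T f) \<le> C * l2_norm X f"
    using assms unfolding bounded_ops_def by blast
  have "l2_norm X (T f) \<le> max C 0 * l2_norm X f" if "f \<in> l2 X" for f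
    using C[OF that] mult_right_mono[of C "max C 0" "l2_norm X f"] by simp
  then show ?thesis using that[of "max C 0"] by simp
qed

lemma bounded_opsI:
  assumes "\<And>f. f \<in> l2 X \<Longrightarrow> T f \<in> l2 X"
    and "\<And>f. f \<notin> l2 X \<Longrightarrow> T f = undefined"
    and "\<And>f g. f \<in> l2 X \<Longrightarrow> g \<in> l2 X \<Longrightarrow> T (\<lambda>x. f x + g x) = (\<lambda>x. T f x + T g x)"
    and "\<And>c f. f \<in> l2 X \<Longrightarrow> T (\<lambda>x. c * f x) = (\<lambda>x. c * T f x)"
    and "\<And>f. f \<in> l2 X \<Longrightarrow> l2_norm X (T f) \<le> C * l2_norm X f"
  shows "T \<in> bounded_ops X"
  unfolding bounded_ops_def using assms(1-4)
  by (intro CollectI conjI exI[of _ C] ballI allI PiE_I assms(5))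

lemma bounded_ops_eqI:
  "T \<in> bounded_ops X \<Longrightarrow> S \<in> bounded_ops X \<Longrightarrow> (\<And>f. f \<in> l2 X \<Longrightarrow> T f = S f) \<Longrightarrow> T = S"
  by (rule ext) (metis bounded_opsD(4))

lemma bounded_op_tendsto:
  assumes T: "T \<in> bounded_ops X" and s: "\<And>n. s n \<in> l2 X" "f \<in> l2 X"
    and lim: "(\<lambda>n. l2_norm X (\<lambda>x. s n x - f x)) \<longlonglongrightarrow> 0"
  shows "(\<lambda>n. l2_norm X (\<lambda>x. T (s n) x - T f x)) \<longlonglongrightarrow> 0"
proof -
  obtain C where C: "\<And>f. f \<in> l2 X \<Longrightarrow> l2_norm X (T f) \<le> C * l2_norm X f"
    using bounded_op_bound[OF T] by blast
  have z: "(\<lambda>n. C * l2_norm X (\<lambda>x. s n x - f x)) \<longlonglongrightarrow> 0"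
    using tendsto_mult[OF tendsto_const[of C] lim] by simp
  have "norm (l2_norm X (\<lambda>x. T (s n) x - T f x)) \<le> C * l2_norm X (\<lambda>x. s n x - f x)" for n
    using C[OF l2_diff[OF s(1) s(2)], of n] by (simp add: bounded_op_diff[OF T s(1) s(2)])
  then show ?thesis
    by (intro Lim_null_comparison[OF _ z] always_eventually allI)
qed

lemma bounded_ops_scalar: "(\<lambda>f\<in>l2 X. \<lambda>x. c * f x) \<in> bounded_ops X"
  by (rule bounded_opsI[where C = "cmod c"])
    (simp_all add: l2_scale l2_add l2_norm_scale algebra_simps)

lemma bounded_ops_id: "(\<lambda>f\<in>l2 X. f) \<in> bounded_ops X"
  using bounded_ops_scalar[where c = 1] by simp

lemma bounded_ops_compose:
  assumes T: "T \<in> bounded_ops X" and S: "S \<in> bounded_ops X"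
  shows "compose (l2 X) T S \<in> bounded_ops X"
proof -
  obtain C where C: "C \<ge> 0" "\<And>f. f \<in> l2 X \<Longrightarrow> l2_norm X (T f) \<le> C * l2_norm X f"
    using bounded_op_bound[OF T] by blast
  obtain D where D: "\<And>f. f \<in> l2 X \<Longrightarrow> l2_norm X (S f) \<le> D * l2_norm X f"
    using bounded_op_bound[OF S] by blast
  show ?thesis
  proof (rule bounded_opsI[where C = "C * D"])
    fix f assume f: "f \<in> l2 X"
    have "l2_norm X (T (S f)) \<le> C * l2_norm X (S f)" by (rule C(2)[OF bounded_opsD(1)[OF S f]])
    also have "\<dots> \<le> C * (D * l2_norm X f)" by (rule mult_left_mono[OF D[OF f] C(1)])
    finally show "l2_norm X (compose (l2 X) T S f) \<le> C * D * l2_norm X f"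
      using f by (simp add: compose_eq)
  qed (simp_all add: compose_eq bounded_opsD[OF T] bounded_opsD[OF S] l2_add l2_scale,
      simp add: compose_def)
qed

lemma closed_subspace_equalizer:
  assumes V: "closed_subspace X V" and T: "T \<in> bounded_ops X" and S: "S \<in> bounded_ops X"
  shows "closed_subspace X {f\<in>V. T f = S f}"
  unfolding closed_subspace_def
proof (intro conjI allI impI ballI)
  fix s f assume s: "(\<forall>n::nat. s n \<in> {f\<in>V. T f = S f}) \<and> f \<in> l2 X \<and>
    (\<lambda>n. l2_norm X (\<lambda>x. s n x - f x)) \<longlonglongrightarrow> 0"
  then have sV: "\<And>n. s n \<in> V" and eq: "\<And>n. T (s n) = S (s n)" and f: "f \<in> l2 X"
    and lim: "(\<lambda>n. l2_norm X (\<lambda>x. s n x - f x)) \<longlonglongrightarrow> 0"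
    by auto
  note sl2 = closed_subspaceD(1)[OF V sV]
  have "T f = S f"
    by (rule l2_limit_unique[of "\<lambda>n. T (s n)"])
      (use bounded_op_tendsto[OF T sl2 f lim] bounded_op_tendsto[OF S sl2 f lim] in
        \<open>simp_all add: bounded_opsD(1)[OF T] bounded_opsD(1)[OF S] sl2 f flip: eq\<close>)
  then show "f \<in> {f\<in>V. T f = S f}" using closed_subspaceD(5)[OF V sV f lim] by simp
qed (use closed_subspaceD(1-4)[OF V] in
    \<open>auto simp: bounded_op_zero[OF T] bounded_op_zero[OF S] bounded_opsD(2,3)[OF T] bounded_opsD(2,3)[OF S]\<close>)

text \<open>
  Every bounded linear functional is an inner product: the representing vector spans the orthogonal
  complement of the kernel.
\<close>
theorem riesz_representation_l2:
  fixes \<phi> :: "('x \<Rightarrow> complex) \<Rightarrow> complex"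
  assumes add: "\<And>f g. f \<in> l2 X \<Longrightarrow> g \<in> l2 X \<Longrightarrow> \<phi> (\<lambda>x. f x + g x) = \<phi> f + \<phi> g"
    and scale: "\<And>c f. f \<in> l2 X \<Longrightarrow> \<phi> (\<lambda>x. c * f x) = c * \<phi> f"
    and bound: "\<And>f. f \<in> l2 X \<Longrightarrow> cmod (\<phi> f) \<le> C * l2_norm X f"
  shows "\<exists>u\<in>l2 X. \<forall>f\<in>l2 X. \<phi> f = l2_inner X f u"
proof (cases "\<forall>f\<in>l2 X. \<phi> f = 0")
  case True
  then show ?thesis by (intro bexI[of _ "\<lambda>x. 0"]) simp_all
next
  case False
  then obtain f where f: "f \<in> l2 X" "\<phi> f \<noteq> 0" by blast
  have diff: "\<phi> (\<lambda>x. f x - g x) = \<phi> f - \<phi> g" if "f \<in> l2 X" "g \<in> l2 X" for f g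
    using add[OF that(1) l2_scale[OF that(2), of "-1"]] scale[OF that(2), of "-1"] by simp
  let ?K = "{f\<in>l2 X. \<phi> f = 0}"
  have K: "closed_subspace X ?K"
    unfolding closed_subspace_def
  proof (intro conjI allI impI ballI)
    show "(\<lambda>x. 0) \<in> ?K" using scale[of "\<lambda>x. 0" 0] by simp
  next
    fix s f assume s: "(\<forall>n::nat. s n \<in> ?K) \<and> f \<in> l2 X \<and>
      (\<lambda>n. l2_norm X (\<lambda>x. s n x - f x)) \<longlonglongrightarrow> 0"
    then have sl2: "\<And>n. s n \<in> l2 X" and f: "f \<in> l2 X"
      and lim: "(\<lambda>n. l2_norm X (\<lambda>x. s n x - f x)) \<longlonglongrightarrow> 0"
      by auto
    have "(\<lambda>n. C * l2_norm X (\<lambda>x. s n x - f x)) \<longlonglongrightarrow> 0"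
      using tendsto_mult[OF tendsto_const[of C] lim] by simp
    moreover have "cmod (\<phi> f) \<le> C * l2_norm X (\<lambda>x. s n x - f x)" for n
      using bound[OF l2_diff[OF sl2 f], of n] s by (simp add: diff[OF sl2 f])
    ultimately have "cmod (\<phi> f) \<le> 0" by (intro LIMSEQ_le_const) auto
    then show "f \<in> ?K" using f by simp
  qed (auto simp: add scale l2_add l2_scale)
  obtain p where p: "p \<in> ?K" "\<And>g. g \<in> ?K \<Longrightarrow> l2_inner X (\<lambda>x. f x - p x) g = 0"
    using orthogonal_projection_exists[OF K f(1)] by blast
  define u where "u = (\<lambda>x. f x - p x)"
  have u: "u \<in> l2 X" and "\<phi> u = \<phi> f" using p(1) f(1) by (auto simp: u_def l2_diff diff)
  then have \<phi>u: "\<phi> u \<noteq> 0" using f(2) by simp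
  have "u \<noteq> (\<lambda>x. 0)" using \<phi>u scale[of "\<lambda>x. 0" 0] by auto
  then have n: "l2_inner X u u \<noteq> 0" using l2_inner_self_eq_0[OF u] by blast
  have "\<phi> g = l2_inner X g (\<lambda>x. cnj (\<phi> u / l2_inner X u u) * u x)" if g: "g \<in> l2 X" for g
  proof -
    let ?k = "\<lambda>x. g x - (\<phi> g / \<phi> u) * u x"
    have "\<phi> ?k = \<phi> g - \<phi> g / \<phi> u * \<phi> u"
      by (simp only: diff[OF g l2_scale[OF u]] scale[OF u])
    then have "\<phi> ?k = 0" using \<phi>u by simp
    then have "?k \<in> ?K" using l2_diff[OF g l2_scale[OF u]] by blast
    then have "l2_inner X ?k u = 0"
      using p(2)[of ?k] unfolding u_def[symmetric] by (metis l2_inner_commute complex_cnj_zero)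
    then have "l2_inner X g u = \<phi> g / \<phi> u * l2_inner X u u"
      by (simp only: l2_inner_diff_left[OF g l2_scale[OF u] u] l2_inner_scale_left) simp
    then show ?thesis using n \<phi>u unfolding l2_inner_scale_right by simp
  qed
  then show ?thesis using u by (intro bexI[of _ "\<lambda>x. cnj (\<phi> u / l2_inner X u u) * u x"] ballI l2_scale)
qed

lemma is_adjointD: "is_adjoint X T S \<Longrightarrow> f \<in> l2 X \<Longrightarrow> g \<in> l2 X \<Longrightarrow> l2_inner X (T f) g = l2_inner X f (S g)"
  by (simp add: is_adjoint_def)

lemma is_adjoint_sym: "is_adjoint X T S \<Longrightarrow> is_adjoint X S T"
  unfolding is_adjoint_def by (metis l2_inner_commute)

theorem adjoint_exists:
  assumes T: "T \<in> bounded_ops X"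
  obtains S where "S \<in> bounded_ops X" "is_adjoint X T S"
proof -
  obtain C where C: "C \<ge> 0" "\<And>f. f \<in> l2 X \<Longrightarrow> l2_norm X (T f) \<le> C * l2_norm X f"
    using bounded_op_bound[OF T] by blast
  have "\<exists>u\<in>l2 X. \<forall>f\<in>l2 X. l2_inner X (T f) g = l2_inner X f u" if g: "g \<in> l2 X" for g
  proof (rule riesz_representation_l2[where C = "C * l2_norm X g"])
    fix f assume f: "f \<in> l2 X"
    have "cmod (l2_inner X (T f) g) \<le> l2_norm X (T f) * l2_norm X g"
      by (rule Cauchy_Schwarz_l2[OF bounded_opsD(1)[OF T f] g])
    also have "\<dots> \<le> (C * l2_norm X f) * l2_norm X g"
      by (rule mult_right_mono[OF C(2)[OF f]]) simp
    finally show "cmod (l2_inner X (T f) g) \<le> C * l2_norm X g * l2_norm X f"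
      by (simp add: mult_ac)
  qed (simp_all add: bounded_opsD[OF T] l2_inner_add_left l2_inner_scale_left g)
  then obtain S0 where S0: "\<And>g. g \<in> l2 X \<Longrightarrow> S0 g \<in> l2 X"
    "\<And>f g. f \<in> l2 X \<Longrightarrow> g \<in> l2 X \<Longrightarrow> l2_inner X (T f) g = l2_inner X f (S0 g)" by metis
  define S where "S = (\<lambda>g\<in>l2 X. S0 g)"
  have adj: "is_adjoint X T S" using S0(2) by (auto simp: is_adjoint_def S_def)
  have "S \<in> bounded_ops X"
  proof (rule bounded_opsI[where C = C])
    fix f g assume fg: "f \<in> l2 X" "g \<in> l2 X"
    show "S (\<lambda>x. f x + g x) = (\<lambda>x. S f x + S g x)"
      by (rule l2_eqI'[of _ X])
        (simp_all add: S_def S0(1) fg l2_add l2_inner_add_right bounded_opsD(1)[OF T] flip: S0(2))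
  next
    fix c f assume f: "f \<in> l2 X"
    show "S (\<lambda>x. c * f x) = (\<lambda>x. c * S f x)"
      by (rule l2_eqI'[of _ X])
        (simp_all add: S_def S0(1) f l2_scale l2_inner_scale_right flip: S0(2))
  next
    fix g assume g: "g \<in> l2 X"
    let ?n = "l2_norm X (S g)"
    have Sg: "S g \<in> l2 X" using g S0(1) by (simp add: S_def)
    have "?n * ?n = cmod (l2_inner X (S g) (S g))"
      by (simp add: l2_inner_self[OF Sg] norm_power power2_eq_square norm_mult)
    also have "l2_inner X (S g) (S g) = l2_inner X (T (S g)) g" using is_adjointD[OF adj Sg g] by simp
    also have "cmod \<dots> \<le> l2_norm X (T (S g)) * l2_norm X g"
      by (rule Cauchy_Schwarz_l2[OF bounded_opsD(1)[OF T Sg] g])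
    also have "\<dots> \<le> (C * ?n) * l2_norm X g" by (rule mult_right_mono[OF C(2)[OF Sg]]) simp
    finally have le: "?n * ?n \<le> ?n * (C * l2_norm X g)" by (simp add: mult_ac)
    show "?n \<le> C * l2_norm X g"
    proof (cases "?n = 0")
      case True then show ?thesis using C(1) by simp
    next
      case False
      then have "?n > 0" by (simp add: order_less_le)
      then show ?thesis using le mult_le_cancel_left_pos by blast
    qed
  qed (simp_all add: S_def S0(1))
  then show ?thesis using that adj by blast
qed

section \<open>Orthogonal projections as operators\<close>

text \<open>
  The orthogonal projection onto \<open>V\<close> as an extensional operator. The choice is unique when \<open>V\<close> is a
  closed subspace, see \<open>proj_unique\<close>; otherwise the value has no meaning.
\<close>
definition proj :: "'x set \<Rightarrow> ('x \<Rightarrow> complex) set \<Rightarrow> 'x operator" where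
  "proj X V = (\<lambda>f\<in>l2 X. SOME p. p \<in> V \<and> (\<forall>g\<in>V. l2_inner X (\<lambda>x. f x - p x) g = 0))"

lemma proj_mem:
  assumes "closed_subspace X V" "f \<in> l2 X"
  shows "proj X V f \<in> V" and "g \<in> V \<Longrightarrow> l2_inner X (\<lambda>x. f x - proj X V f x) g = 0"
proof -
  have "\<exists>p. p \<in> V \<and> (\<forall>g\<in>V. l2_inner X (\<lambda>x. f x - p x) g = 0)"
    using orthogonal_projection_exists[OF assms] by blast
  from someI_ex[OF this] show "proj X V f \<in> V"
    and "g \<in> V \<Longrightarrow> l2_inner X (\<lambda>x. f x - proj X V f x) g = 0"
    using assms(2) by (auto simp: proj_def)
qed

lemma proj_unique:
  assumes V: "closed_subspace X V" and f: "f \<in> l2 X" and p: "p \<in> V"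
    and orth: "\<And>g. g \<in> V \<Longrightarrow> l2_inner X (\<lambda>x. f x - p x) g = 0"
  shows "proj X V f = p"
proof -
  let ?q = "proj X V f"
  note q = proj_mem[OF V f]
  note l2 = closed_subspaceD(1)[OF V]
  have d: "(\<lambda>x. ?q x - p x) \<in> V" by (rule closed_subspace_diff[OF V q(1) p])
  have "l2_inner X (\<lambda>x. ?q x - p x) (\<lambda>x. ?q x - p x) =
     l2_inner X (\<lambda>x. f x - p x) (\<lambda>x. ?q x - p x) - l2_inner X (\<lambda>x. f x - ?q x) (\<lambda>x. ?q x - p x)"
    using l2_inner_diff_left[OF l2_diff[OF f l2[OF p]] l2_diff[OF f l2[OF q(1)]] l2[OF d]] by simp
  also have "\<dots> = 0" using orth[OF d] q(2)[OF d] by simp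
  finally have "(\<lambda>x. ?q x - p x) = (\<lambda>x. 0)" by (rule l2_inner_self_eq_0[OF l2[OF d]])
  then show ?thesis by (simp add: fun_eq_iff)
qed

lemma proj_self: "closed_subspace X V \<Longrightarrow> f \<in> V \<Longrightarrow> proj X V f = f"
  by (rule proj_unique) (auto intro: closed_subspaceD(1))

lemma l2_inner_proj:
  assumes V: "closed_subspace X V" and f: "f \<in> l2 X" and g: "g \<in> V"
  shows "l2_inner X f g = l2_inner X (proj X V f) g"
  using proj_mem[OF V f] g closed_subspaceD(1)[OF V] f by (simp add: l2_inner_diff_left)

lemma proj_is_adjoint:
  assumes V: "closed_subspace X V"
  shows "is_adjoint X (proj X V) (proj X V)"
  unfolding is_adjoint_def
proof (intro ballI)
  fix f g assume fg: "f \<in> l2 X" "g \<in> l2 X"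
  have "l2_inner X f (proj X V g) = l2_inner X (proj X V f) (proj X V g)"
    by (rule l2_inner_proj[OF V fg(1) proj_mem(1)[OF V fg(2)]])
  also have "\<dots> = cnj (l2_inner X g (proj X V f))"
    using l2_inner_proj[OF V fg(2) proj_mem(1)[OF V fg(1)]] by (metis l2_inner_commute)
  also have "\<dots> = l2_inner X (proj X V f) g" by (metis l2_inner_commute)
  finally show "l2_inner X (proj X V f) g = l2_inner X f (proj X V g)" ..
qed

lemma proj_bounded:
  assumes V: "closed_subspace X V"
  shows "proj X V \<in> bounded_ops X"
proof (rule bounded_opsI[where C = 1])
  note l2 = closed_subspaceD(1)[OF V]
  fix f assume f: "f \<in> l2 X"
  note p = proj_mem[OF V f]
  let ?p = "proj X V f"
  show "?p \<in> l2 X" using l2[OF p(1)] .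
  have "l2_norm X ?p * l2_norm X ?p = cmod (l2_inner X f ?p)"
    using l2_inner_proj[OF V f p(1)]
    by (simp add: l2_inner_self[OF l2[OF p(1)]] norm_power power2_eq_square norm_mult)
  also have "\<dots> \<le> l2_norm X f * l2_norm X ?p" by (rule Cauchy_Schwarz_l2[OF f l2[OF p(1)]])
  finally have le: "l2_norm X ?p * l2_norm X ?p \<le> l2_norm X f * l2_norm X ?p" .
  show "l2_norm X ?p \<le> 1 * l2_norm X f"
  proof (cases "l2_norm X ?p = 0")
    case False
    then have "l2_norm X ?p > 0" by (simp add: order_less_le)
    then show ?thesis using le by simp
  qed simp
  fix c
  show "proj X V (\<lambda>x. c * f x) = (\<lambda>x. c * ?p x)"
    using proj_mem[OF V f] l2 f l2_inner_scale_left[of X c "\<lambda>x. f x - ?p x"]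
    by (intro proj_unique[OF V]) (auto simp: l2_scale algebra_simps closed_subspaceD(4)[OF V])
  fix g assume g: "g \<in> l2 X"
  let ?q = "proj X V g"
  show "proj X V (\<lambda>x. f x + g x) = (\<lambda>x. ?p x + ?q x)"
  proof (rule proj_unique[OF V])
    fix h assume h: "h \<in> V"
    have "l2_inner X (\<lambda>x. (f x - ?p x) + (g x - ?q x)) h = 0"
      using proj_mem[OF V f] proj_mem[OF V g] h f g l2
      by (subst l2_inner_add_left) (auto intro: l2_diff)
    then show "l2_inner X (\<lambda>x. f x + g x - (?p x + ?q x)) h = 0" by (simp add: algebra_simps)
  qed (use f g proj_mem(1)[OF V f] proj_mem(1)[OF V g] in \<open>auto intro: l2_add closed_subspaceD(3)[OF V]\<close>)
qed (simp add: proj_def)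

text \<open>
  A projection commutes with every operator that, together with its adjoint, preserves its range.
\<close>
lemma proj_commute:
  assumes V: "closed_subspace X V" and T: "T \<in> bounded_ops X" and adj: "is_adjoint X T S"
    and TV: "\<And>f. f \<in> V \<Longrightarrow> T f \<in> V" and SV: "\<And>f. f \<in> V \<Longrightarrow> S f \<in> V" and f: "f \<in> l2 X"
  shows "proj X V (T f) = T (proj X V f)"
proof (rule proj_unique[OF V])
  note l2 = closed_subspaceD(1)[OF V]
  note p = proj_mem[OF V f]
  show "T f \<in> l2 X" by (rule bounded_opsD(1)[OF T f])
  show "T (proj X V f) \<in> V" by (rule TV[OF p(1)])
  fix g assume g: "g \<in> V"
  have "(\<lambda>x. T f x - T (proj X V f) x) = T (\<lambda>x. f x - proj X V f x)"
    by (rule bounded_op_diff[OF T f l2[OF p(1)], symmetric])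
  then have "l2_inner X (\<lambda>x. T f x - T (proj X V f) x) g = l2_inner X (T (\<lambda>x. f x - proj X V f x)) g"
    by simp
  also have "\<dots> = l2_inner X (\<lambda>x. f x - proj X V f x) (S g)"
    by (rule is_adjointD[OF adj l2_diff[OF f l2[OF p(1)]] l2[OF g]])
  also have "\<dots> = 0" by (rule p(2)[OF SV[OF g]])
  finally show "l2_inner X (\<lambda>x. T f x - T (proj X V f) x) g = 0" .
qed

lemma proj_idem:
  assumes V: "closed_subspace X V"
  shows "compose (l2 X) (proj X V) (proj X V) = proj X V"
  by (rule bounded_ops_eqI[OF bounded_ops_compose])
    (simp_all add: proj_bounded[OF V] compose_eq proj_self[OF V] proj_mem(1)[OF V])

section \<open>Commutants\<close>

lemma commutant_subset: "commutant X M \<subseteq> bounded_ops X"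
  by (auto simp: commutant_def)

lemma commutantD:
  assumes "T \<in> commutant X M" "S \<in> M" "f \<in> l2 X"
  shows "T (S f) = S (T f)"
proof -
  have "compose (l2 X) T S = compose (l2 X) S T" using assms by (auto simp: commutant_def)
  then have "compose (l2 X) T S f = compose (l2 X) S T f" by (rule fun_cong)
  then show ?thesis using assms(3) by (simp add: compose_eq)
qed

lemma commutantI:
  assumes "T \<in> bounded_ops X" "\<And>S f. S \<in> M \<Longrightarrow> f \<in> l2 X \<Longrightarrow> T (S f) = S (T f)"
  shows "T \<in> commutant X M"
  using assms by (auto simp: commutant_def compose_def fun_eq_iff)

lemma commutant_antimono: "M \<subseteq> N \<Longrightarrow> commutant X N \<subseteq> commutant X M"
  by (auto simp: commutant_def)

lemma subset_bicommutant: "M \<subseteq> bounded_ops X \<Longrightarrow> M \<subseteq> commutant X (commutant X M)"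
  by (auto simp: commutant_def)

lemma triple_commutant:
  assumes "M \<subseteq> bounded_ops X"
  shows "commutant X (commutant X (commutant X M)) = commutant X M"
  using subset_bicommutant[OF assms] subset_bicommutant[OF commutant_subset]
  by (metis commutant_antimono subset_antisym)

text \<open>
  Sets of bounded operators that contain an adjoint of each of their members.
\<close>
definition self_adjoint_set :: "'x set \<Rightarrow> 'x operator set \<Rightarrow> bool" where
  "self_adjoint_set X M \<longleftrightarrow> M \<subseteq> bounded_ops X \<and> (\<forall>T\<in>M. \<exists>S\<in>M. is_adjoint X T S)"

lemma self_adjoint_commutant:
  assumes "self_adjoint_set X M"
  shows "self_adjoint_set X (commutant X M)"
  unfolding self_adjoint_set_def
proof (intro conjI ballI commutant_subset)
  fix T assume T: "T \<in> commutant X M"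
  then have Tb: "T \<in> bounded_ops X" using commutant_subset by blast
  obtain T' where T': "T' \<in> bounded_ops X" "is_adjoint X T T'" using adjoint_exists[OF Tb] by blast
  have "T' (S f) = S (T' f)" if S: "S \<in> M" and f: "f \<in> l2 X" for S f
  proof (rule l2_eqI')
    obtain S' where S': "S' \<in> M" "is_adjoint X S S'"
      using assms S by (auto simp: self_adjoint_set_def)
    have Sb: "S \<in> bounded_ops X" "S' \<in> bounded_ops X"
      using assms S S'(1) by (auto simp: self_adjoint_set_def)
    note mem = bounded_opsD(1)[OF Tb] bounded_opsD(1)[OF T'(1)]
      bounded_opsD(1)[OF Sb(1)] bounded_opsD(1)[OF Sb(2)]
    note adj = is_adjointD[OF T'(2)] is_adjointD[OF is_adjoint_sym[OF S'(2)]]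
    show "T' (S f) \<in> l2 X" "S (T' f) \<in> l2 X" using f mem by auto
    fix h assume h: "h \<in> l2 X"
    have "l2_inner X h (T' (S f)) = l2_inner X (T h) (S f)" using adj(1) h f mem by simp
    also have "\<dots> = l2_inner X (S' (T h)) f" using adj(2) h f mem by simp
    also have "S' (T h) = T (S' h)" using commutantD[OF T S'(1) h] by simp
    also have "l2_inner X (T (S' h)) f = l2_inner X (S' h) (T' f)" using adj(1) h f mem by simp
    also have "\<dots> = l2_inner X h (S (T' f))" using adj(2) h f mem by simp
    finally show "l2_inner X h (T' (S f)) = l2_inner X h (S (T' f))" .
  qed
  then show "\<exists>S\<in>commutant X M. is_adjoint X T S"
    using T' by (intro bexI[of _ T'] commutantI) auto
qed

text \<open>
  With von Neumann algebras defined as self-adjoint sets equal to their bicommutant, the generated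
  algebra of a self-adjoint set is its bicommutant.
\<close>
theorem von_neumann_generated_eq_bicommutant:
  assumes "self_adjoint_set X M"
  shows "von_neumann_algebra X (commutant X (commutant X M))"
    and "von_neumann_generated X M = commutant X (commutant X M)"
proof -
  have Mb: "M \<subseteq> bounded_ops X" using assms by (simp add: self_adjoint_set_def)
  show vN: "von_neumann_algebra X (commutant X (commutant X M))"
    using self_adjoint_commutant[OF self_adjoint_commutant[OF assms]]
      triple_commutant[OF commutant_subset]
    by (simp add: von_neumann_algebra_def self_adjoint_set_def)
  have "commutant X (commutant X M) \<subseteq> N" if "von_neumann_algebra X N" "M \<subseteq> N" for N
    using that by (metis commutant_antimono von_neumann_algebra_def)
  then show "von_neumann_generated X M = commutant X (commutant X M)"
    unfolding von_neumann_generated_def using vN subset_bicommutant[OF Mb] by blast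
qed

section \<open>Finite-dimensional subspaces\<close>

lemma vector_space_complex_fun:
  "vector_space (\<lambda>(c::complex) (f::'x \<Rightarrow> complex) x. c * f x)"
  by standard (simp_all add: fun_eq_iff algebra_simps)

text \<open>
  A function supported in a finite set \<open>D\<close> is a linear combination of basis vectors.
\<close>
lemma in_span_delta:
  fixes f :: "'x \<Rightarrow> complex"
  assumes "finite D" "\<And>x. x \<notin> D \<Longrightarrow> f x = 0"
  shows "f \<in> module.span (\<lambda>c f x. c * f x) (delta ` D)"
proof -
  interpret vector_space "\<lambda>(c::complex) (f::'x \<Rightarrow> complex) x. c * f x"
    by (rule vector_space_complex_fun)
  have "f = (\<Sum>y\<in>D. (\<lambda>x. f y * delta y x))"
  proof
    fix x
    have "(\<Sum>y\<in>D. (\<lambda>x. f y * delta y x)) x = (\<Sum>y\<in>D. f y * delta y x)"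
      using assms(1) by (induction D rule: finite_induct) auto
    also have "\<dots> = (\<Sum>y\<in>D. if y = x then f y else 0)"
      by (intro sum.cong) (auto simp: delta_def)
    also have "\<dots> = f x" using assms by simp
    finally show "f x = (\<Sum>y\<in>D. (\<lambda>x. f y * delta y x)) x" ..
  qed
  also have "\<dots> \<in> span (delta ` D)"
    by (intro span_sum span_scale span_base) auto
  finally show ?thesis .
qed

text \<open>
  Closed subspaces of functions supported in a fixed finite set \<open>D\<close> carry a numerical dimension.
  Only its strict monotonicity is needed below, as a termination measure and to find minimal subspaces.
\<close>
lemma exists_strict_dimension:
  fixes X :: "'x set"
  assumes D: "finite D"
  shows "\<exists>\<mu>::('x \<Rightarrow> complex) set \<Rightarrow> nat. \<forall>V W. closed_subspace X V \<longrightarrow> closed_subspace X W \<longrightarrow>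
    V \<subset> W \<longrightarrow> (\<forall>f\<in>W. \<forall>x. x \<notin> D \<longrightarrow> f x = 0) \<longrightarrow> \<mu> V < \<mu> W"
proof -
  interpret vector_space "\<lambda>(c::complex) (f::'x \<Rightarrow> complex) x. c * f x"
    by (rule vector_space_complex_fun)
  have "dim V < dim W" if V: "closed_subspace X V" and W: "closed_subspace X W"
    and VW: "V \<subset> W" and supp: "\<forall>f\<in>W. \<forall>x. x \<notin> D \<longrightarrow> f x = 0" for V W
  proof -
    have sub: "subspace V"
      using closed_subspaceD(2-4)[OF V] by (auto simp: subspace_def plus_fun_def zero_fun_def)
    have W_span: "W \<subseteq> span (delta ` D)" using in_span_delta[OF D] supp by blast
    obtain B where B: "B \<subseteq> V" "independent B" "V \<subseteq> span B" "card B = dim V"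
      by (rule basis_exists)
    obtain w where w: "w \<in> W" "w \<notin> V" using VW by blast
    then have "w \<notin> span B" using span_minimal[OF B(1) sub] by blast
    then have ind: "independent (insert w B)" using B(2) by (rule independent_insertI)
    obtain B' where B': "insert w B \<subseteq> B'" "B' \<subseteq> W" "independent B'" "W \<subseteq> span B'"
      using maximal_independent_subset_extend[OF _ ind, of W] w(1) B(1) VW by blast
    have fin: "finite B'"
      using independent_span_bound[OF finite_imageI[OF D] B'(3)] B'(2) W_span by blast
    have "dim V < card (insert w B)"
      using B(4) w(2) B(1) finite_subset[OF B'(1) fin] by (auto simp: card_insert_if)
    also have "\<dots> \<le> card B'" by (rule card_mono[OF fin B'(1)])
    also have "\<dots> = dim W" by (rule basis_card_eq_dim[OF B'(2,4,3)])
    finally show ?thesis .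
  qed
  then show ?thesis by blast
qed

text \<open>
  A sequence of functions supported in a finite set satisfies a nontrivial linear relation, whose
  coefficients are recorded as those of a polynomial, in view of the eigenvector lemma below.
\<close>
lemma exists_linear_relation:
  fixes a :: "nat \<Rightarrow> 'x \<Rightarrow> complex"
  assumes D: "finite D" and supp: "\<And>i x. x \<notin> D \<Longrightarrow> a i x = 0"
  shows "\<exists>p::complex poly. p \<noteq> 0 \<and> (\<forall>x. (\<Sum>i\<le>degree p. coeff p i * a i x) = 0)"
proof -
  interpret vector_space "\<lambda>(c::complex) (f::'x \<Rightarrow> complex) x. c * f x"
    by (rule vector_space_complex_fun)
  let ?n = "card D"
  \<comment> \<open>Among \<open>card D + 1\<close> members of the family either two coincide or the set of them is dependent.\<close>
  have "\<exists>c. (\<exists>i\<le>?n. c i \<noteq> 0) \<and> (\<forall>x. (\<Sum>i\<le>?n. c i * a i x) = 0)"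
  proof (cases "inj_on a {..?n}")
    case True
    have "\<not> card (a ` {..?n}) \<le> card (delta ` D)"
      using card_image[OF True] card_image_le[OF D, of delta] by simp
    moreover have "a ` {..?n} \<subseteq> span (delta ` D)" using in_span_delta[OF D] supp by blast
    ultimately have "dependent (a ` {..?n})"
      using independent_span_bound[OF finite_imageI[OF D]] by blast
    then obtain u v where u: "v \<in> a ` {..?n}" "u v \<noteq> 0" "(\<Sum>v\<in>a ` {..?n}. (\<lambda>x. u v * v x)) = 0"
      using dependent_finite[of "a ` {..?n}"] by auto
    have "(\<Sum>i\<le>?n. u (a i) * a i x) = 0" for x
    proof -
      have ap: "(\<Sum>v\<in>A. (\<lambda>x. u v * v x)) x = (\<Sum>v\<in>A. u v * v x)" if "finite A" for A
        using that by (induction A rule: finite_induct) auto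
      have "(\<Sum>i\<le>?n. u (a i) * a i x) = (\<Sum>v\<in>a ` {..?n}. u v * v x)"
        by (simp add: sum.reindex[OF True])
      also have "\<dots> = 0" using fun_cong[OF u(3), of x] ap by simp
      finally show ?thesis .
    qed
    then show ?thesis using u(1,2) by (intro exI[of _ "\<lambda>i. u (a i)"]) auto
  next
    case False
    then obtain i j where ij: "i \<le> ?n" "j \<le> ?n" "i \<noteq> j" "a i = a j" by (auto simp: inj_on_def)
    let ?c = "\<lambda>k. of_bool (k = i) - of_bool (k = j) :: complex"
    have "(\<Sum>k\<le>?n. ?c k * a k x) = (\<Sum>k\<le>?n. if k = i then a k x else 0) - (\<Sum>k\<le>?n. if k = j then a k x else 0)" for x
      unfolding sum_subtractf[symmetric] by (intro sum.cong) auto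
    then have *: "(\<Sum>k\<le>?n. ?c k * a k x) = 0" for x using ij by simp
    have "?c i \<noteq> 0" using ij(3) by simp
    then show ?thesis by (intro exI[of _ ?c] conjI allI * exI[of _ i] ij(1))
  qed
  then obtain c where c: "\<exists>i\<le>?n. c i \<noteq> 0" "\<And>x. (\<Sum>i\<le>?n. c i * a i x) = 0" by blast
  define p where "p = (\<Sum>i\<le>?n. monom (c i) i)"
  have coeff: "coeff p i = (if i \<le> ?n then c i else 0)" for i
    by (simp add: p_def coeff_sum)
  have "p \<noteq> 0" using c(1) coeff by (metis coeff_0)
  moreover have "(\<Sum>i\<le>degree p. coeff p i * a i x) = 0" for x
  proof -
    have "degree p \<le> ?n" by (rule degree_le) (simp add: coeff)
    then have "(\<Sum>i\<le>degree p. coeff p i * a i x) = (\<Sum>i\<le>?n. coeff p i * a i x)"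
      by (intro sum.mono_neutral_left) (auto intro: coeff_eq_0)
    also have "\<dots> = (\<Sum>i\<le>?n. c i * a i x)" by (intro sum.cong) (auto simp: coeff)
    finally show ?thesis using c(2) by simp
  qed
  ultimately show ?thesis by blast
qed

lemma bounded_op_sum:
  assumes T: "T \<in> bounded_ops X" and v: "\<And>i. i \<in> I \<Longrightarrow> v i \<in> l2 X"
  shows "T (\<lambda>x. \<Sum>i\<in>I. c i * v i x) = (\<lambda>x. \<Sum>i\<in>I. c i * T (v i) x)"
  using v
proof (induction I rule: infinite_finite_induct)
  case (insert i I)
  have "T (\<lambda>x. c i * v i x + (\<Sum>i\<in>I. c i * v i x)) = (\<lambda>x. T (\<lambda>x. c i * v i x) x + T (\<lambda>x. \<Sum>i\<in>I. c i * v i x) x)"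
    using insert.prems by (intro bounded_opsD(2)[OF T] l2_scale l2_sum) auto
  then show ?case
    using insert bounded_opsD(3)[OF T, of "v i" "c i"] by simp
qed (simp_all add: bounded_op_zero[OF T])

text \<open>
  An operator preserving a nonzero space of functions on a finite set has an eigenvector there. For
  a polynomial \<open>p\<close> of least degree annihilating a vector \<open>w\<close> under the operator, and a root \<open>z\<close>
  of \<open>p = (X - z) q\<close>, the vector \<open>q(T) w\<close> is one.
\<close>
lemma eigenvector_exists:
  assumes D: "finite D" and V: "closed_subspace X V" and nz: "V \<noteq> {\<lambda>x. 0}"
    and supp: "\<forall>f\<in>V. \<forall>x. x \<notin> D \<longrightarrow> f x = 0"
    and T: "T \<in> bounded_ops X" and TV: "\<And>f. f \<in> V \<Longrightarrow> T f \<in> V"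
  obtains v c where "v \<in> V" "v \<noteq> (\<lambda>x. 0)" "T v = (\<lambda>x. c * v x)"
proof -
  obtain w where w: "w \<in> V" "w \<noteq> (\<lambda>x. 0)" using nz closed_subspaceD(2)[OF V] by blast
  define a where "a i = (T ^^ i) w" for i
  have aV: "a i \<in> V" for i unfolding a_def by (induction i) (auto simp: w(1) TV)
  have al2: "a i \<in> l2 X" for i by (rule closed_subspaceD(1)[OF V aV])
  have Ta: "T (a i) = a (Suc i)" for i by (simp add: a_def)
  define ev where "ev p = (\<lambda>x. \<Sum>i\<le>degree p. coeff p i * a i x)" for p
  have ev_le: "ev p = (\<lambda>x. \<Sum>i\<le>n. coeff p i * a i x)" if "degree p \<le> n" for p n
    unfolding ev_def using that by (intro ext sum.mono_neutral_left) (auto intro: coeff_eq_0)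
  have evV: "ev p \<in> V" for p
    unfolding ev_def by (intro closed_subspace_sum[OF V] closed_subspaceD(4)[OF V] aV)
  have "a i x = 0" if "x \<notin> D" for i x using supp aV that by simp
  from exists_linear_relation[of D a, OF D this]
  obtain p0 :: "complex poly" where "p0 \<noteq> 0" "\<forall>x. (\<Sum>i\<le>degree p0. coeff p0 i * a i x) = 0"
    by metis
  then have "p0 \<noteq> 0 \<and> ev p0 = (\<lambda>x. 0)" by (simp add: ev_def)
  from ex_has_least_nat[of "\<lambda>p. p \<noteq> 0 \<and> ev p = (\<lambda>x. 0)" p0 degree, OF this]
  obtain p where p: "p \<noteq> 0" "ev p = (\<lambda>x. 0)"
    and least: "\<And>q. q \<noteq> 0 \<Longrightarrow> ev q = (\<lambda>x. 0) \<Longrightarrow> degree p \<le> degree q"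
    by blast
  have "degree p \<noteq> 0"
  proof
    assume "degree p = 0"
    then have "ev p = (\<lambda>x. coeff p 0 * w x)" "coeff p 0 \<noteq> 0"
      using p(1) leading_coeff_neq_0[of p] by (auto simp: ev_def a_def)
    then show False using p(2) w(2) by (auto simp: fun_eq_iff)
  qed
  then obtain z where "poly p z = 0"
    using fundamental_theorem_of_algebra[of p] constant_degree[of p] by auto
  then obtain q where q: "p = [:-z, 1:] * q" by (auto simp: poly_eq_0_iff_dvd)
  have q0: "q \<noteq> 0" using p(1) q by auto
  have dq: "degree p = Suc (degree q)" unfolding q using q0 by (subst degree_mult_eq) auto
  let ?v = "ev q"
  have v0: "?v \<noteq> (\<lambda>x. 0)" using least[OF q0] dq by auto
  have cp: "coeff p i = (case i of 0 \<Rightarrow> 0 | Suc j \<Rightarrow> coeff q j) - z * coeff q i" for i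
    unfolding q by (simp add: coeff_pCons algebra_simps split: nat.split)
  have "T ?v x - z * ?v x = ev p x" for x
  proof -
    let ?n = "degree q"
    have "T ?v x = (\<Sum>i\<le>?n. coeff q i * a (Suc i) x)"
      unfolding ev_def by (subst bounded_op_sum[OF T al2]) (simp add: Ta)
    also have "\<dots> = (\<Sum>i\<le>Suc ?n. (case i of 0 \<Rightarrow> 0 | Suc j \<Rightarrow> coeff q j) * a i x)"
      by (subst sum.atMost_Suc_shift) simp
    finally have "T ?v x - z * ?v x = (\<Sum>i\<le>Suc ?n. (case i of 0 \<Rightarrow> 0 | Suc j \<Rightarrow> coeff q j) * a i x)
        - (\<Sum>i\<le>Suc ?n. z * coeff q i * a i x)"
      by (simp add: ev_le[of q "Suc ?n"] sum_distrib_left mult.assoc del: sum.atMost_Suc)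
    also have "\<dots> = (\<Sum>i\<le>Suc ?n. coeff p i * a i x)"
      unfolding sum_subtractf[symmetric] by (intro sum.cong) (simp_all add: cp left_diff_distrib)
    finally show ?thesis by (simp add: ev_def dq)
  qed
  then have "T ?v = (\<lambda>x. z * ?v x)" using p(2) by (auto simp: fun_eq_iff)
  then show ?thesis using that evV v0 by blast
qed

section \<open>The representation of a group on \<open>l\<^sup>2(G/H)\<close>\<close>

lemma closed_subspace_INT:
  assumes "I \<noteq> {}" "\<And>i. i \<in> I \<Longrightarrow> closed_subspace X (V i)"
  shows "closed_subspace X (\<Inter>i\<in>I. V i)"
proof -
  obtain i where i: "i \<in> I" using assms(1) by blast
  show ?thesis
    unfolding closed_subspace_def
  proof (intro conjI allI impI ballI INT_I subsetI)
    fix f assume "f \<in> (\<Inter>i\<in>I. V i)"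
    then show "f \<in> l2 X" using closed_subspaceD(1)[OF assms(2)[OF i]] i by auto
  next
    fix i assume i: "i \<in> I"
    note D = closed_subspaceD[OF assms(2)[OF i]]
    show "(\<lambda>x. 0) \<in> V i" by (rule D(2))
    show "(\<lambda>x. f x + g x) \<in> V i" if "f \<in> (\<Inter>i\<in>I. V i)" "g \<in> (\<Inter>i\<in>I. V i)" for f g
      by (rule D(3)) (use that i in auto)
    show "(\<lambda>x. c * f x) \<in> V i" if "f \<in> (\<Inter>i\<in>I. V i)" for c f
      by (rule D(4)) (use that i in auto)
    show "f \<in> V i" if "(\<forall>n. s n \<in> (\<Inter>i\<in>I. V i)) \<and> f \<in> l2 X \<and>
        (\<lambda>n. l2_norm X (\<lambda>x. s n x - f x)) \<longlonglongrightarrow> 0" for s f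
      by (rule D(5)[of s]) (use that i in auto)
  qed
qed

text \<open>
  A group \<open>G\<close> with a subgroup \<open>H\<close>, acting on \<open>l\<^sup>2(G/H)\<close> by left translations.
\<close>
locale coset_rep = group G for G (structure) +
  fixes H
  assumes subgroup: "subgroup H G"
begin

abbreviation X where "X \<equiv> lcosets H"
abbreviation U where "U \<equiv> induced_trivial G H"

lemma H_subset: "H \<subseteq> carrier G"
  by (rule subgroup.subset[OF subgroup])

lemma coset_subset: "C \<in> X \<Longrightarrow> C \<subseteq> carrier G"
  using subgroup group_axioms subgroup.lcosets_carrier by blast

lemma coset_in_X [intro]: "g \<in> carrier G \<Longrightarrow> g <# H \<in> X"
  by (auto simp: LCOSETS_def)

lemma coset_obtain:
  assumes "C \<in> X" obtains g where "g \<in> carrier G" "C = g <# H"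
  using assms by (auto simp: LCOSETS_def)

lemma translate_in_X [intro]: "g \<in> carrier G \<Longrightarrow> C \<in> X \<Longrightarrow> g <# C \<in> X"
  using lcosets_translate_bij[OF subgroup, of g] by (auto simp: bij_betw_def)

lemma H_in_X: "H \<in> X"
  using coset_in_X[OF one_closed] H_subset by (simp add: lcos_mult_one)

lemma H_translate: "h \<in> H \<Longrightarrow> h <# H = H"
  using H_subset subgroup by (intro coset_join3) auto

lemma translate_inv:
  "g \<in> carrier G \<Longrightarrow> C \<in> X \<Longrightarrow> inv g <# (g <# C) = C"
  "g \<in> carrier G \<Longrightarrow> C \<in> X \<Longrightarrow> g <# (inv g <# C) = C"
  by (simp_all add: lcos_m_assoc coset_subset lcos_mult_one)

lemma unitary_rep: "unitary_rep G X U"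
  by (rule unitary_rep_induced_trivial[OF subgroup])

lemma U_bounded: "g \<in> carrier G \<Longrightarrow> U g \<in> bounded_ops X"
  using unitary_rep by (auto simp: unitary_rep_def unitary_ops_def)

lemma U_l2: "g \<in> carrier G \<Longrightarrow> f \<in> l2 X \<Longrightarrow> U g f \<in> l2 X"
  by (rule bounded_opsD(1)[OF U_bounded])

lemma U_apply: "f \<in> l2 X \<Longrightarrow> C \<in> X \<Longrightarrow> U g f C = f (inv g <# C)"
  by (simp add: induced_trivial_def)

lemma U_off: "f \<in> l2 X \<Longrightarrow> C \<notin> X \<Longrightarrow> U g f C = 0"
  by (simp add: induced_trivial_def)

lemma U_inv:
  assumes "g \<in> carrier G" "f \<in> l2 X"
  shows "U g (U (inv g) f) = f"
proof
  fix C show "U g (U (inv g) f) C = f C"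
    using assms by (cases "C \<in> X")
      (auto simp: U_apply U_off U_l2 translate_in_X translate_inv l2_off)
qed

lemma U_inner:
  "g \<in> carrier G \<Longrightarrow> f \<in> l2 X \<Longrightarrow> f' \<in> l2 X \<Longrightarrow> l2_inner X (U g f) (U g f') = l2_inner X f f'"
  using unitary_rep by (auto simp: unitary_rep_def unitary_ops_def)

lemma U_adjoint:
  assumes g: "g \<in> carrier G"
  shows "is_adjoint X (U g) (U (inv g))"
  unfolding is_adjoint_def
  using U_inner[OF g] U_inv[OF g] U_l2[OF inv_closed[OF g]] by metis

lemma self_adjoint_U: "self_adjoint_set X (U ` carrier G)"
  unfolding self_adjoint_set_def using U_bounded U_adjoint by blast

lemma U_delta:
  assumes g: "g \<in> carrier G" and C: "C \<in> X"
  shows "U g (delta C) = delta (g <# C)"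
proof
  fix D
  show "U g (delta C) D = delta (g <# C) D"
  proof (cases "D \<in> X")
    case True
    have "inv g <# D = C \<longleftrightarrow> D = g <# C" using translate_inv g C True by auto
    then show ?thesis using True by (simp add: U_apply delta_l2[OF C]) (simp add: delta_def)
  next
    case False
    then have "D \<noteq> g <# C" using translate_in_X[OF g C] by blast
    then show ?thesis using False by (simp add: U_off delta_l2[OF C]) (simp add: delta_def)
  qed
qed

lemma invariant_subspaceD:
  assumes "invariant_subspace G X U V"
  shows "closed_subspace X V" "g \<in> carrier G \<Longrightarrow> f \<in> V \<Longrightarrow> U g f \<in> V"
  using assms by (auto simp: invariant_subspace_def)

lemma delta_H_cyclic:
  assumes V: "invariant_subspace G X U V" and H: "delta H \<in> V"
  shows "V = l2 X"
proof (rule closed_subspace_eq_l2I[OF invariant_subspaceD(1)[OF V]])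
  fix C assume "C \<in> X"
  then obtain g where "g \<in> carrier G" "C = g <# H" by (rule coset_obtain)
  then show "delta C \<in> V"
    using invariant_subspaceD(2)[OF V _ H, of g] U_delta[OF _ H_in_X, of g] by simp
qed

text \<open>
  Since \<open>delta H\<close> is cyclic, it separates the commutant of the representation.
\<close>
lemma commuting_op_eq_zero:
  assumes T: "T \<in> bounded_ops X"
    and comm: "\<And>g f. g \<in> carrier G \<Longrightarrow> f \<in> l2 X \<Longrightarrow> T (U g f) = U g (T f)"
    and 0: "T (delta H) = (\<lambda>x. 0)" and f: "f \<in> l2 X"
  shows "T f = (\<lambda>x. 0)"
proof -
  \<comment> \<open>The zero operator, written as a scalar multiple of the identity.\<close>
  have zero: "(\<lambda>f\<in>l2 X. \<lambda>x. 0 * f x) \<in> bounded_ops X" by (rule bounded_ops_scalar)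
  let ?Z = "{f\<in>l2 X. T f = (\<lambda>f\<in>l2 X. \<lambda>x. 0 * f x) f}"
  have "invariant_subspace G X U ?Z"
    unfolding invariant_subspace_def
    using closed_subspace_equalizer[OF closed_subspace_l2 T zero] comm bounded_op_zero[OF U_bounded]
    by (auto simp: U_l2)
  moreover have "delta H \<in> ?Z" using 0 delta_l2[OF H_in_X] by simp
  ultimately have "?Z = l2 X" by (rule delta_H_cyclic)
  then have "f \<in> ?Z" using f by blast
  then show ?thesis using f by simp
qed

lemma invariant_l2: "invariant_subspace G X U (l2 X)"
  by (simp add: invariant_subspace_def closed_subspace_l2 U_l2)

section \<open>Vectors fixed by \<open>H\<close>\<close>

text \<open>
  The space of vectors fixed by the subgroup \<open>H\<close>.
\<close>
definition fixed :: "('a set \<Rightarrow> complex) set" where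
  "fixed = {f\<in>l2 X. \<forall>h\<in>H. U h f = f}"

lemma closed_fixed: "closed_subspace X fixed"
proof -
  have "fixed = (\<Inter>h\<in>H. {f\<in>l2 X. U h f = (\<lambda>f\<in>l2 X. f) f})"
    using subgroup.one_closed[OF subgroup] by (auto simp: fixed_def)
  also have "closed_subspace X \<dots>"
    using H_subset subgroup.one_closed[OF subgroup]
    by (intro closed_subspace_INT closed_subspace_equalizer closed_subspace_l2 U_bounded
        bounded_ops_id) auto
  finally show ?thesis .
qed

lemma delta_H_fixed: "delta H \<in> fixed"
  using H_subset by (auto simp: fixed_def delta_l2 H_in_X U_delta H_translate)

text \<open>
  The set of those cosets (points of \<open>G/H\<close>, not orbits) whose orbit under the action of \<open>H\<close> is
  finite.
\<close>
definition finite_orbits :: "'a set set" where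
  "finite_orbits = {C\<in>X. finite ((\<lambda>h. h <# C) ` H)}"

lemma fixed_supp:
  assumes f: "f \<in> fixed" and C: "C \<notin> finite_orbits"
  shows "f C = 0"
proof (rule ccontr)
  assume nz: "f C \<noteq> 0"
  have fl2: "f \<in> l2 X" using f by (simp add: fixed_def)
  then have CX: "C \<in> X" using nz l2_off[OF fl2, of C] by blast
  have const: "f (h <# C) = f C" if h: "h \<in> H" for h
  proof -
    have hG: "h \<in> carrier G" using h H_subset by blast
    have "f (h <# C) = U h f (h <# C)" using f h by (simp add: fixed_def)
    also have "\<dots> = f C" using hG CX by (simp add: U_apply[OF fl2] translate_in_X translate_inv)
    finally show ?thesis .
  qed
  have "infinite ((\<lambda>h. h <# C) ` H)" using C CX by (simp add: finite_orbits_def)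
  \<comment> \<open>Already \<open>n\<close> points of the orbit exceed the norm of \<open>f\<close>.\<close>
  obtain n :: nat where n: "(l2_norm X f)\<^sup>2 / (cmod (f C))\<^sup>2 < real n"
    using reals_Archimedean2 by blast
  obtain F where F: "finite F" "card F = n" "F \<subseteq> (\<lambda>h. h <# C) ` H"
    using infinite_arbitrarily_large[OF \<open>infinite _\<close>] by blast
  have "F \<subseteq> X" using F(3) H_subset CX translate_in_X by blast
  have "real n * (cmod (f C))\<^sup>2 = (\<Sum>D\<in>F. (cmod (f D))\<^sup>2)"
    using F(3) const by (subst sum.cong[OF refl, of _ _ "\<lambda>_. (cmod (f C))\<^sup>2"]) (auto simp: F(2))
  also have "\<dots> \<le> (l2_norm X f)\<^sup>2"
    unfolding l2_norm_sq by (rule finite_sum_le_infsum[OF l2_summable[OF fl2] F(1) \<open>F \<subseteq> X\<close>]) simp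
  finally show False using n nz by (simp add: divide_less_eq)
qed

text \<open>
  The witness is the projection of \<open>delta H\<close> onto \<open>V\<close>: it is fixed by \<open>H\<close> as the projection commutes
  with \<open>U\<close>, and it is nonzero as \<open>delta H\<close> is cyclic.
\<close>
lemma fixed_meets_invariant:
  assumes V: "invariant_subspace G X U V" and nz: "V \<noteq> {\<lambda>x. 0}"
  obtains f where "f \<in> V" "f \<in> fixed" "f \<noteq> (\<lambda>x. 0)"
proof -
  note Vc = invariant_subspaceD(1)[OF V]
  have d: "delta H \<in> l2 X" by (rule delta_l2[OF H_in_X])
  let ?p = "proj X V (delta H)"
  note p = proj_mem[OF Vc d]
  have comm: "proj X V (U g f) = U g (proj X V f)" if "g \<in> carrier G" "f \<in> l2 X" for g f
    using that invariant_subspaceD(2)[OF V]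
    by (intro proj_commute[OF Vc U_bounded U_adjoint]) auto
  have "?p \<in> fixed"
    using closed_subspaceD(1)[OF Vc p(1)] comm[OF _ d] delta_H_fixed H_subset
    by (auto simp: fixed_def) (metis subsetD)
  moreover have "?p \<noteq> (\<lambda>x. 0)"
  proof
    assume 0: "?p = (\<lambda>x. 0)"
    have "f = (\<lambda>x. 0)" if "f \<in> V" for f
      using commuting_op_eq_zero[OF proj_bounded[OF Vc] comm 0 closed_subspaceD(1)[OF Vc that]]
        proj_self[OF Vc that] by simp
    then show False using nz closed_subspaceD(2)[OF Vc] by blast
  qed
  ultimately show ?thesis using that p(1) by blast
qed

theorem irreducible_if_single_finite_orbit:
  assumes "finite_orbits \<subseteq> {H}"
  shows "irreducible_rep G X U"
  unfolding irreducible_rep_def irreducible_subrep_def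
proof (intro conjI unitary_rep invariant_l2 allI impI)
  show "l2 X \<noteq> {\<lambda>x. 0}" using delta_l2[OF H_in_X] delta_neq_0[of H] by auto
  fix V assume "invariant_subspace G X U V \<and> V \<subseteq> l2 X"
  then have V: "invariant_subspace G X U V" by blast
  show "V = {\<lambda>x. 0} \<or> V = l2 X"
  proof (rule disjCI)
    assume "V \<noteq> l2 X"
    show "V = {\<lambda>x. 0}"
    proof (rule ccontr)
      assume "V \<noteq> {\<lambda>x. 0}"
      then obtain f where f: "f \<in> V" "f \<in> fixed" "f \<noteq> (\<lambda>x. 0)"
        by (rule fixed_meets_invariant[OF V])
      have supp: "f C = 0" if "C \<noteq> H" for C
      proof (rule fixed_supp[OF f(2)])
        show "C \<notin> finite_orbits" using assms that by blast
      qed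
      have "f H \<noteq> 0"
      proof
        assume "f H = 0"
        then have "f C = 0" for C using supp by (cases "C = H") simp_all
        then show False using f(3) by (simp add: fun_eq_iff)
      qed
      then have "(\<lambda>x. (1 / f H) * f x) = delta H" using supp by (auto simp: delta_def)
      then have "delta H \<in> V"
        using closed_subspaceD(4)[OF invariant_subspaceD(1)[OF V] f(1), of "1 / f H"] by simp
      then show False using delta_H_cyclic[OF V] \<open>V \<noteq> l2 X\<close> by blast
    qed
  qed
qed

section \<open>Finitely many finite orbits\<close>

lemma invariant_orthogonal:
  assumes V: "invariant_subspace G X U V" and W: "invariant_subspace G X U W"
  shows "invariant_subspace G X U {f\<in>V. \<forall>g\<in>W. l2_inner X f g = 0}"
  unfolding invariant_subspace_def
proof (intro conjI ballI)
  note l2V = closed_subspaceD(1)[OF invariant_subspaceD(1)[OF V]]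
  note l2W = closed_subspaceD(1)[OF invariant_subspaceD(1)[OF W]]
  show "closed_subspace X {f\<in>V. \<forall>g\<in>W. l2_inner X f g = 0}"
    by (rule closed_subspace_orthogonal[OF invariant_subspaceD(1)[OF V]]) (use l2W in blast)
  fix g f assume g: "g \<in> carrier G" and f: "f \<in> {f\<in>V. \<forall>g\<in>W. l2_inner X f g = 0}"
  have "l2_inner X (U g f) h = 0" if h: "h \<in> W" for h
    using is_adjointD[OF U_adjoint[OF g] l2V l2W[OF h], of f] f
      invariant_subspaceD(2)[OF W inv_closed[OF g] h] by auto
  then show "U g f \<in> {f\<in>V. \<forall>g\<in>W. l2_inner X f g = 0}"
    using f invariant_subspaceD(2)[OF V g] by blast
qed

lemma fixed_dimension:
  assumes "finite finite_orbits"
  obtains \<mu> :: "('a set \<Rightarrow> complex) set \<Rightarrow> nat" where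
    "\<And>V W. closed_subspace X V \<Longrightarrow> closed_subspace X W \<Longrightarrow> V \<subset> W \<Longrightarrow> W \<subseteq> fixed \<Longrightarrow> \<mu> V < \<mu> W"
proof -
  from exists_strict_dimension[OF assms, of X]
  obtain \<mu> where \<mu>: "\<And>V W. closed_subspace X V \<Longrightarrow> closed_subspace X W \<Longrightarrow> V \<subset> W \<Longrightarrow>
      \<forall>f\<in>W. \<forall>x. x \<notin> finite_orbits \<longrightarrow> f x = 0 \<Longrightarrow> \<mu> V < (\<mu> W::nat)"
    by metis
  show ?thesis
  proof (rule that[of \<mu>])
    fix V W :: "('a set \<Rightarrow> complex) set"
    assume V: "closed_subspace X V" and W: "closed_subspace X W" and "V \<subset> W" and fixed: "W \<subseteq> fixed"
    have "\<forall>f\<in>W. \<forall>x. x \<notin> finite_orbits \<longrightarrow> f x = 0"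
    proof (intro ballI allI impI)
      fix f x assume "f \<in> W" "x \<notin> finite_orbits"
      then show "f x = 0" using fixed_supp[of f x] subsetD[OF fixed] by blast
    qed
    then show "\<mu> V < \<mu> W" by (rule \<mu>[OF V W \<open>V \<subset> W\<close>])
  qed
qed

text \<open>
  \<open>\<V>\<close> is a finite set of pairwise orthogonal irreducible subrepresentations of \<open>V\<close> with sum \<open>V\<close>.
\<close>
definition irreducible_decomposition ::
    "('a set \<Rightarrow> complex) set \<Rightarrow> ('a set \<Rightarrow> complex) set set \<Rightarrow> bool" where
  "irreducible_decomposition V \<V> \<longleftrightarrow>
    finite \<V> \<and> (\<forall>W\<in>\<V>. irreducible_subrep G X U W \<and> W \<subseteq> V) \<and>
    (\<forall>W\<in>\<V>. \<forall>W'\<in>\<V>. W \<noteq> W' \<longrightarrow> (\<forall>f\<in>W. \<forall>g\<in>W'. l2_inner X f g = 0)) \<and>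
    (\<forall>f\<in>V. \<exists>v. (\<forall>W\<in>\<V>. v W \<in> W) \<and> f = (\<lambda>x. \<Sum>W\<in>\<V>. v W x))"

lemma irreducible_decompositionD:
  assumes "irreducible_decomposition V \<V>"
  shows "finite \<V>" "W \<in> \<V> \<Longrightarrow> irreducible_subrep G X U W" "W \<in> \<V> \<Longrightarrow> W \<subseteq> V"
    "W \<in> \<V> \<Longrightarrow> W' \<in> \<V> \<Longrightarrow> W \<noteq> W' \<Longrightarrow> f \<in> W \<Longrightarrow> g \<in> W' \<Longrightarrow> l2_inner X f g = 0"
    "f \<in> V \<Longrightarrow> \<exists>v. (\<forall>W\<in>\<V>. v W \<in> W) \<and> f = (\<lambda>x. \<Sum>W\<in>\<V>. v W x)"
  using assms unfolding irreducible_decomposition_def by simp_all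

text \<open>
  By induction on the dimension of \<open>V \<inter> fixed\<close>. If \<open>V\<close> is reducible, it is the sum of a subrepresentation
  and its orthogonal complement in \<open>V\<close>; each of the two contains a nonzero fixed vector that the
  other does not contain.
\<close>
lemma irreducible_decomposition_exists:
  assumes fin: "finite finite_orbits" and V: "invariant_subspace G X U V"
  shows "\<exists>\<V>. irreducible_decomposition V \<V>"
proof -
  obtain \<mu> :: "('a set \<Rightarrow> complex) set \<Rightarrow> nat" where \<mu>: "\<And>V W. closed_subspace X V \<Longrightarrow>
      closed_subspace X W \<Longrightarrow> V \<subset> W \<Longrightarrow> W \<subseteq> fixed \<Longrightarrow> \<mu> V < \<mu> W"
    using fixed_dimension[OF fin] by blast
  have rank_less: "\<mu> (W \<inter> fixed) < \<mu> (V \<inter> fixed)"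
    if V: "invariant_subspace G X U V" and W: "invariant_subspace G X U W"
      and W': "invariant_subspace G X U W'" and sub: "W \<subseteq> V" "W' \<subseteq> V"
      and nz: "W' \<noteq> {\<lambda>x. 0}" and orth: "\<And>f g. f \<in> W \<Longrightarrow> g \<in> W' \<Longrightarrow> l2_inner X f g = 0"
    for V W W'
  proof (rule \<mu>)
    obtain f where f: "f \<in> W'" "f \<in> fixed" "f \<noteq> (\<lambda>x. 0)"
      using fixed_meets_invariant[OF W' nz] by blast
    have "f \<notin> W" using orth[OF _ f(1)] l2_inner_self_eq_0[of f X] f by (auto simp: fixed_def)
    then show "W \<inter> fixed \<subset> V \<inter> fixed" using sub f by blast
  qed (use V W in \<open>auto intro: closed_subspace_Int closed_fixed invariant_subspaceD(1)\<close>)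
  show ?thesis
    using V
  proof (induction "\<mu> (V \<inter> fixed)" arbitrary: V rule: less_induct)
    case less
    note V = less.prems
    note Vc = invariant_subspaceD(1)[OF V]
    show ?case
    proof (cases "V = {\<lambda>x. 0} \<or> irreducible_subrep G X U V")
      case True
      then show ?thesis
      proof
        assume "V = {\<lambda>x. 0}"
        then have "irreducible_decomposition V {}" by (simp add: irreducible_decomposition_def)
        then show ?thesis ..
      next
        assume "irreducible_subrep G X U V"
        moreover have "\<exists>v. (\<forall>W\<in>{V}. v W \<in> W) \<and> f = (\<lambda>x. \<Sum>W\<in>{V}. v W x)" if "f \<in> V" for f
          using that by (intro exI[of _ "\<lambda>_. f"]) simp
        ultimately have "irreducible_decomposition V {V}"
          unfolding irreducible_decomposition_def by (intro conjI) simp_all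
        then show ?thesis ..
      qed
    next
      case False
      then obtain W where W: "invariant_subspace G X U W" and WV: "W \<subseteq> V"
        and nz: "W \<noteq> {\<lambda>x. 0}" and ne: "W \<noteq> V"
        using V by (auto simp: irreducible_subrep_def)
      define W' where "W' = {f\<in>V. \<forall>g\<in>W. l2_inner X f g = 0}"
      note Wc = invariant_subspaceD(1)[OF W]
      have W': "invariant_subspace G X U W'" unfolding W'_def by (rule invariant_orthogonal[OF V W])
      have orth': "l2_inner X f g = 0" if "f \<in> W'" "g \<in> W" for f g using that by (auto simp: W'_def)
      have orth: "l2_inner X f g = 0" if "f \<in> W" "g \<in> W'" for f g
        using orth'[OF that(2,1)] by (metis l2_inner_commute complex_cnj_zero)
      have comp: "(\<lambda>x. f x - proj X W f x) \<in> W'" "proj X W f \<in> W" if f: "f \<in> V" for f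
      proof -
        have fl2: "f \<in> l2 X" by (rule closed_subspaceD(1)[OF Vc f])
        show p: "proj X W f \<in> W" by (rule proj_mem(1)[OF Wc fl2])
        then show "(\<lambda>x. f x - proj X W f x) \<in> W'"
          using proj_mem(2)[OF Wc fl2] closed_subspace_diff[OF Vc f, of "proj X W f"] WV
          by (auto simp: W'_def)
      qed
      have W'V: "W' \<subseteq> V" by (auto simp: W'_def)
      have nz': "W' \<noteq> {\<lambda>x. 0}"
      proof
        assume 0: "W' = {\<lambda>x. 0}"
        have "f \<in> W" if "f \<in> V" for f
        proof -
          have "(\<lambda>x. f x - proj X W f x) = (\<lambda>x. 0)" using comp(1)[OF that] 0 by blast
          then have "f = proj X W f" by (simp add: fun_eq_iff)
          then show ?thesis using comp(2)[OF that] by simp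
        qed
        then show False using WV ne by blast
      qed
      obtain \<V>1 where "irreducible_decomposition W \<V>1"
        using less.hyps[OF rank_less[OF V W W' WV W'V nz' orth] W] by blast
      note \<V>1 = irreducible_decompositionD[OF this]
      obtain \<V>2 where "irreducible_decomposition W' \<V>2"
        using less.hyps[OF rank_less[OF V W' W W'V WV nz orth'] W'] by blast
      note \<V>2 = irreducible_decompositionD[OF this]
      have disj: "\<V>1 \<inter> \<V>2 = {}"
      proof (rule ccontr)
        assume "\<V>1 \<inter> \<V>2 \<noteq> {}"
        then obtain Y where Y: "Y \<in> \<V>1" "Y \<in> \<V>2" by blast
        have "f = (\<lambda>x. 0)" if "f \<in> Y" for f
        proof (rule l2_inner_self_eq_0[of _ X])
          show "f \<in> l2 X" using \<V>1(3)[OF Y(1)] that by (blast intro: closed_subspaceD(1)[OF Wc])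
          show "l2_inner X f f = 0" using orth[of f f] \<V>1(3)[OF Y(1)] \<V>2(3)[OF Y(2)] that by blast
        qed
        moreover have "(\<lambda>x. 0) \<in> Y" "Y \<noteq> {\<lambda>x. 0}"
          using \<V>1(2)[OF Y(1)]
          by (auto simp: irreducible_subrep_def intro: closed_subspaceD(2) invariant_subspaceD(1))
        ultimately show False by blast
      qed
      have "irreducible_decomposition V (\<V>1 \<union> \<V>2)"
        unfolding irreducible_decomposition_def
      proof (intro conjI ballI impI)
        fix Y Y' f g assume Y: "Y \<in> \<V>1 \<union> \<V>2" "Y' \<in> \<V>1 \<union> \<V>2" "Y \<noteq> Y'" "f \<in> Y" "g \<in> Y'"
        consider "Y \<in> \<V>1" "Y' \<in> \<V>1" | "Y \<in> \<V>1" "Y' \<in> \<V>2" | "Y \<in> \<V>2" "Y' \<in> \<V>1" | "Y \<in> \<V>2" "Y' \<in> \<V>2"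
          using Y(1,2) by blast
        then show "l2_inner X f g = 0"
        proof cases
          case 1 then show ?thesis using \<V>1(4) Y(3-5) by blast
        next
          case 2 then show ?thesis using orth \<V>1(3) \<V>2(3) Y(4,5) by blast
        next
          case 3 then show ?thesis using orth' \<V>1(3) \<V>2(3) Y(4,5) by blast
        next
          case 4 then show ?thesis using \<V>2(4) Y(3-5) by blast
        qed
      next
        fix f assume f: "f \<in> V"
        obtain v1 where v1: "\<And>Y. Y \<in> \<V>1 \<Longrightarrow> v1 Y \<in> Y" "proj X W f = (\<lambda>x. \<Sum>Y\<in>\<V>1. v1 Y x)"
          using \<V>1(5)[OF comp(2)[OF f]] by blast
        obtain v2 where v2: "\<And>Y. Y \<in> \<V>2 \<Longrightarrow> v2 Y \<in> Y"
          "(\<lambda>x. f x - proj X W f x) = (\<lambda>x. \<Sum>Y\<in>\<V>2. v2 Y x)"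
          using \<V>2(5)[OF comp(1)[OF f]] by blast
        let ?v = "\<lambda>Y. if Y \<in> \<V>1 then v1 Y else v2 Y"
        have "f x = (\<Sum>Y\<in>\<V>1 \<union> \<V>2. ?v Y x)" for x
        proof -
          have "(\<Sum>Y\<in>\<V>1 \<union> \<V>2. ?v Y x) = (\<Sum>Y\<in>\<V>1. ?v Y x) + (\<Sum>Y\<in>\<V>2. ?v Y x)"
            by (rule sum.union_disjoint[OF \<V>1(1) \<V>2(1) disj])
          also have "(\<Sum>Y\<in>\<V>1. ?v Y x) = proj X W f x" unfolding v1(2) by (rule sum.cong) auto
          also have "(\<Sum>Y\<in>\<V>2. ?v Y x) = (\<Sum>Y\<in>\<V>2. v2 Y x)" using disj by (intro sum.cong) auto
          also have "\<dots> = f x - proj X W f x" using fun_cong[OF v2(2), of x] by simp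
          finally show ?thesis by simp
        qed
        then show "\<exists>v. (\<forall>Y\<in>\<V>1 \<union> \<V>2. v Y \<in> Y) \<and> f = (\<lambda>x. \<Sum>Y\<in>\<V>1 \<union> \<V>2. v Y x)"
          using v1(1) v2(1) by (intro exI[of _ ?v]) auto
      next
        show "finite (\<V>1 \<union> \<V>2)" using \<V>1(1) \<V>2(1) by blast
      next
        fix Y assume "Y \<in> \<V>1 \<union> \<V>2"
        then consider "Y \<in> \<V>1" | "Y \<in> \<V>2" by blast
        then have "irreducible_subrep G X U Y \<and> Y \<subseteq> V"
        proof cases
          case 1 show ?thesis using \<V>1(2,3)[OF 1] WV by simp
        next
          case 2 show ?thesis using \<V>2(2,3)[OF 2] W'V by simp
        qed
        then show "irreducible_subrep G X U Y" "Y \<subseteq> V" by simp_all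
      qed
      then show ?thesis ..
    qed
  qed
qed

theorem finite_sum_if_finite_orbits:
  assumes "finite finite_orbits"
  shows "finite_sum_of_irreducibles G X U"
proof -
  obtain \<V> where "irreducible_decomposition (l2 X) \<V>"
    using irreducible_decomposition_exists[OF assms invariant_l2] by blast
  note \<V> = irreducible_decompositionD[OF this]
  obtain V where V: "bij_betw V {..<card \<V>} \<V>"
    using ex_bij_betw_nat_finite[OF \<V>(1)] by (auto simp: atLeast0LessThan)
  have VV: "V i \<in> \<V>" if "i < card \<V>" for i using V that by (auto simp: bij_betw_def)
  have inj: "V i \<noteq> V j" if "i < card \<V>" "j < card \<V>" "i \<noteq> j" for i j
    using V that by (auto simp: bij_betw_def inj_on_def)
  have "\<exists>v. (\<forall>i<card \<V>. v i \<in> V i) \<and> f = (\<lambda>x. \<Sum>i<card \<V>. v i x)" if f: "f \<in> l2 X" for f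
  proof -
    obtain v where v: "\<And>W. W \<in> \<V> \<Longrightarrow> v W \<in> W" "f = (\<lambda>x. \<Sum>W\<in>\<V>. v W x)"
      using \<V>(5)[OF f] by metis
    have "f = (\<lambda>x. \<Sum>i<card \<V>. v (V i) x)"
      unfolding v(2) by (rule ext) (rule sum.reindex_bij_betw[OF V, symmetric])
    then show ?thesis using v(1)[OF VV] by (intro exI[of _ "\<lambda>i. v (V i)"]) simp
  qed
  then show ?thesis
    unfolding finite_sum_of_irreducibles_def
    using \<V>(2)[OF VV] \<V>(4)[OF VV VV inj] unitary_rep
    by (intro conjI exI[of _ "card \<V>"] exI[of _ V]) simp_all
qed

text \<open>
  Below, \<open>A\<close> is the commutant of the representation and \<open>R\<close> the von Neumann algebra
  generated by the representation. A nonzero abelian projection under a central projection \<open>z\<close> is found as the projection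
  onto a minimal nonzero \<open>A\<close>-invariant subspace \<open>W\<close> of \<open>W0 = {f \<in> fixed. z f = f}\<close>.
\<close>
theorem type_I_if_finite_orbits:
  assumes fin: "finite finite_orbits"
  shows "type_I_rep G X U"
proof -
  define A where "A = commutant X (U ` carrier G)"
  define R where "R = commutant X A"
  have A_sa: "self_adjoint_set X A" unfolding A_def by (rule self_adjoint_commutant[OF self_adjoint_U])
  have Ab: "T \<in> bounded_ops X" if "T \<in> A" for T using that commutant_subset unfolding A_def by blast
  have Rb: "T \<in> bounded_ops X" if "T \<in> R" for T using that commutant_subset unfolding R_def by blast
  have AU: "T (U g f) = U g (T f)" if "T \<in> A" "g \<in> carrier G" "f \<in> l2 X" for T g f
    using commutantD[of T X "U ` carrier G"] that unfolding A_def by blast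
  have RA: "S (T f) = T (S f)" if "S \<in> R" "T \<in> A" "f \<in> l2 X" for S T f
    using commutantD[of S X A] that unfolding R_def by blast
  have UR: "U g \<in> R" if "g \<in> carrier G" for g
    unfolding R_def A_def using subset_bicommutant[of "U ` carrier G" X] U_bounded that by blast
  have gen: "von_neumann_generated X (U ` carrier G) = R" and vN: "von_neumann_algebra X R"
    unfolding R_def A_def using von_neumann_generated_eq_bicommutant[OF self_adjoint_U] by auto
  obtain \<mu> :: "('a set \<Rightarrow> complex) set \<Rightarrow> nat" where \<mu>: "\<And>V W. closed_subspace X V \<Longrightarrow>
      closed_subspace X W \<Longrightarrow> V \<subset> W \<Longrightarrow> W \<subseteq> fixed \<Longrightarrow> \<mu> V < \<mu> W"
    using fixed_dimension[OF fin] by blast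
  have "\<exists>e. abelian_projection X R e \<and> e \<noteq> (\<lambda>f\<in>l2 X. \<lambda>x. 0) \<and> compose (l2 X) z e = e"
    if z: "z \<in> projections X (R \<inter> commutant X R)" and z0: "z \<noteq> (\<lambda>f\<in>l2 X. \<lambda>x. 0)" for z
  proof -
    have zR: "z \<in> R" and zR': "z \<in> commutant X R" and zz: "compose (l2 X) z z = z"
      using z by (auto simp: projections_def)
    note zb = Rb[OF zR]
    have zU: "z (U g f) = U g (z f)" if "g \<in> carrier G" "f \<in> l2 X" for g f
      using commutantD[OF zR' UR] that by blast
    have z_idem: "z (z f) = z f" if "f \<in> l2 X" for f
      using fun_cong[OF zz, of f] that by (simp add: compose_eq)
    define W0 where "W0 = {f\<in>fixed. z f = (\<lambda>f\<in>l2 X. f) f}"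
    have W0_iff: "f \<in> W0 \<longleftrightarrow> f \<in> fixed \<and> z f = f" for f by (auto simp: W0_def fixed_def)
    have W0c: "closed_subspace X W0"
      unfolding W0_def by (rule closed_subspace_equalizer[OF closed_fixed zb bounded_ops_id])
    have d: "delta H \<in> l2 X" by (rule delta_l2[OF H_in_X])
    have zd: "z (delta H) \<in> W0"
      using zU[OF _ d] H_subset delta_H_fixed z_idem[OF d] bounded_opsD(1)[OF zb d]
      by (auto simp: W0_iff fixed_def) (metis subsetD)
    have zd0: "z (delta H) \<noteq> (\<lambda>x. 0)"
    proof
      assume 0: "z (delta H) = (\<lambda>x. 0)"
      have "z = (\<lambda>f\<in>l2 X. \<lambda>x. 0)"
      proof
        fix f show "z f = (\<lambda>f\<in>l2 X. \<lambda>x. 0) f"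
          using commuting_op_eq_zero[OF zb zU 0, of f] bounded_opsD(4)[OF zb, of f]
          by (cases "f \<in> l2 X") simp_all
      qed
      then show False using z0 by simp
    qed
    have W0A: "T f \<in> W0" if T: "T \<in> A" and f: "f \<in> W0" for T f
    proof -
      have fl2: "f \<in> l2 X" and fU: "\<And>h. h \<in> H \<Longrightarrow> U h f = f" and zf: "z f = f"
        using f by (auto simp: W0_iff fixed_def)
      have "U h (T f) = T f" if "h \<in> H" for h
        using AU[OF T _ fl2, of h] fU[OF that] that H_subset by auto
      moreover have "z (T f) = T f" using RA[OF zR T fl2] zf by simp
      ultimately show ?thesis using bounded_opsD(1)[OF Ab[OF T] fl2] by (simp add: W0_iff fixed_def)
    qed
    define Q where "Q W \<longleftrightarrow> closed_subspace X W \<and> W \<subseteq> W0 \<and> W \<noteq> {\<lambda>x. 0} \<and> (\<forall>T\<in>A. \<forall>f\<in>W. T f \<in> W)" for W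
    have "Q W0" unfolding Q_def using W0c zd zd0 W0A by blast
    from ex_has_least_nat[of Q W0 \<mu>, OF this]
    obtain W where QW: "Q W" and least: "\<And>W'. Q W' \<Longrightarrow> \<mu> W \<le> \<mu> W'" by blast
    have Wc: "closed_subspace X W" and WW0: "W \<subseteq> W0" and Wnz: "W \<noteq> {\<lambda>x. 0}"
      and WA: "\<And>T f. T \<in> A \<Longrightarrow> f \<in> W \<Longrightarrow> T f \<in> W"
      using QW by (auto simp: Q_def)
    note Wl2 = closed_subspaceD(1)[OF Wc]
    have W_fixed: "W \<subseteq> fixed" using WW0 W0_iff by blast
    define e where "e = proj X W"
    have eb: "e \<in> bounded_ops X" unfolding e_def by (rule proj_bounded[OF Wc])
    have eW: "e f \<in> W" if "f \<in> l2 X" for f unfolding e_def by (rule proj_mem(1)[OF Wc that])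
    have eR: "e \<in> R"
      unfolding R_def
    proof (rule commutantI[OF eb])
      fix T f assume T: "T \<in> A" and f: "f \<in> l2 X"
      obtain S where S: "S \<in> A" "is_adjoint X T S" using A_sa T by (auto simp: self_adjoint_set_def)
      show "e (T f) = T (e f)"
        unfolding e_def by (rule proj_commute[OF Wc Ab[OF T] S(2) WA[OF T] WA[OF S(1)] f])
    qed
    have e_proj: "e \<in> projections X R"
      unfolding projections_def using eR proj_idem[OF Wc] proj_is_adjoint[OF Wc] by (simp add: e_def)
    have supp: "\<forall>f\<in>W. \<forall>x. x \<notin> finite_orbits \<longrightarrow> f x = 0"
    proof (intro ballI allI impI)
      fix f x assume "f \<in> W" "x \<notin> finite_orbits"
      then show "f x = 0" using fixed_supp[of f x] subsetD[OF W_fixed] by blast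
    qed
    \<comment> \<open>The corner \<open>e R e\<close> is scalar: an eigenspace of \<open>e S\<close> in \<open>W\<close> is \<open>A\<close>-invariant, so it is \<open>W\<close>.\<close>
    have scalar: "\<exists>c. \<forall>f\<in>l2 X. e (S (e f)) = (\<lambda>x. c * e f x)" if S: "S \<in> R" for S
    proof -
      note Sb = Rb[OF S]
      define E where "E = compose (l2 X) e S"
      have Eb: "E \<in> bounded_ops X" unfolding E_def by (rule bounded_ops_compose[OF eb Sb])
      have E: "E f = e (S f)" if "f \<in> l2 X" for f using that by (simp add: E_def compose_eq)
      have EW: "E f \<in> W" if "f \<in> W" for f
        using E[OF Wl2[OF that]] eW[OF bounded_opsD(1)[OF Sb Wl2[OF that]]] by simp
      obtain v c where v: "v \<in> W" "v \<noteq> (\<lambda>x. 0)" "E v = (\<lambda>x. c * v x)"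
        by (rule eigenvector_exists[OF fin Wc Wnz supp Eb EW])
      define W' where "W' = {f\<in>W. E f = (\<lambda>f\<in>l2 X. \<lambda>x. c * f x) f}"
      have W'_iff: "f \<in> W' \<longleftrightarrow> f \<in> W \<and> E f = (\<lambda>x. c * f x)" for f
        using Wl2 by (auto simp: W'_def)
      have W'c: "closed_subspace X W'"
        unfolding W'_def by (rule closed_subspace_equalizer[OF Wc Eb bounded_ops_scalar])
      have "T f \<in> W'" if T: "T \<in> A" and f: "f \<in> W'" for T f
      proof -
        have fW: "f \<in> W" and Ef: "E f = (\<lambda>x. c * f x)" using f W'_iff by auto
        note fl2 = Wl2[OF fW]
        note Tb = Ab[OF T]
        have "E (T f) = e (T (S f))" using E[OF bounded_opsD(1)[OF Tb fl2]] RA[OF S T fl2] by simp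
        also have "\<dots> = T (E f)" using RA[OF eR T bounded_opsD(1)[OF Sb fl2]] E[OF fl2] by simp
        also have "\<dots> = (\<lambda>x. c * T f x)" unfolding Ef by (rule bounded_opsD(3)[OF Tb fl2])
        finally show ?thesis using WA[OF T fW] W'_iff by simp
      qed
      then have "Q W'" unfolding Q_def using W'c WW0 v W'_iff by blast
      then have "\<not> W' \<subset> W" using least \<mu>[OF W'c Wc _ W_fixed] by (meson leD)
      then have "W' = W" using W'_iff by blast
      then have "e (S (e f)) = (\<lambda>x. c * e f x)" if "f \<in> l2 X" for f
        using eW[OF that] W'_iff[of "e f"] E[OF Wl2[OF eW[OF that]]] by simp
      then show ?thesis by blast
    qed
    have abel: "abelian_projection X R e"
      unfolding abelian_projection_def Let_def
    proof (intro conjI e_proj ballI)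
      let ?corner = "(\<lambda>T. compose (l2 X) e (compose (l2 X) T e)) ` R"
      have corner: "\<exists>c. \<forall>f\<in>l2 X. K f = (\<lambda>x. c * e f x)" if "K \<in> ?corner" for K
        using that scalar by (auto simp: compose_eq)
      have ee: "e (\<lambda>x. c * e f x) = (\<lambda>x. c * e f x)" if "f \<in> l2 X" for c f
        unfolding e_def by (rule proj_self[OF Wc]) (intro closed_subspaceD(4)[OF Wc] proj_mem(1)[OF Wc] that)
      fix K L assume KL: "K \<in> ?corner" "L \<in> ?corner"
      obtain c where c: "\<And>f. f \<in> l2 X \<Longrightarrow> K f = (\<lambda>x. c * e f x)" using corner[OF KL(1)] by blast
      obtain c' where c': "\<And>f. f \<in> l2 X \<Longrightarrow> L f = (\<lambda>x. c' * e f x)" using corner[OF KL(2)] by blast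
      have l: "(\<lambda>x. a * e f x) \<in> l2 X" if "f \<in> l2 X" for a f
        by (intro l2_scale Wl2 eW that)
      have "K (L f) = L (K f)" if f: "f \<in> l2 X" for f
        by (simp add: c[OF f] c'[OF f] c[OF l[OF f]] c'[OF l[OF f]] ee[OF f] mult_ac)
      then show "compose (l2 X) K L = compose (l2 X) L K" by (auto simp: compose_def fun_eq_iff)
    qed
    have "e \<noteq> (\<lambda>f\<in>l2 X. \<lambda>x. 0)"
    proof
      assume 0: "e = (\<lambda>f\<in>l2 X. \<lambda>x. 0)"
      obtain w where w: "w \<in> W" "w \<noteq> (\<lambda>x. 0)" using Wnz closed_subspaceD(2)[OF Wc] by blast
      have "e w = w" unfolding e_def by (rule proj_self[OF Wc w(1)])
      then show False using 0 w Wl2[OF w(1)] by simp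
    qed
    moreover have "compose (l2 X) z e = e"
      by (rule bounded_ops_eqI[OF bounded_ops_compose[OF zb eb] eb])
        (use eW WW0 W0_iff in \<open>auto simp: compose_eq\<close>)
    ultimately show ?thesis using abel by blast
  qed
  then show ?thesis
    unfolding type_I_rep_def gen type_I_algebra_def using unitary_rep vN by blast
qed

end

section \<open>Overgroups of finite index\<close>

text \<open>
  If \<open>q\<close> factors through \<open>p\<close> on \<open>K\<close> and \<open>p\<close> takes finitely many values, then so does \<open>q\<close>.
\<close>
lemma finite_image_factor:
  assumes "finite (p ` K)" "\<And>x y. x \<in> K \<Longrightarrow> y \<in> K \<Longrightarrow> p x = p y \<Longrightarrow> q x = q y"
  shows "finite (q ` K)"
proof -
  have "q ` K \<subseteq> (\<lambda>s. q (inv_into K p s)) ` p ` K"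
  proof (rule image_subsetI)
    fix x assume x: "x \<in> K"
    then have "p x \<in> p ` K" by blast
    then have "q (inv_into K p (p x)) = q x"
      by (intro assms(2) inv_into_into x f_inv_into_f)
    then show "q x \<in> (\<lambda>s. q (inv_into K p s)) ` p ` K" using x by force
  qed
  then show ?thesis using assms(1) finite_surj by blast
qed

context coset_rep
begin

lemma mem_coset: "g \<in> carrier G \<Longrightarrow> g \<in> g <# H"
  using subgroup.one_closed[OF subgroup] r_one by (force simp: l_coset_def)

text \<open>
  The invariant subspace \<open>V\<close> consists of the functions on \<open>G/H\<close> that factor through \<open>G/K\<close>. Finiteness
  of the index makes the indicator function of \<open>K/H\<close> a nonzero vector of \<open>V\<close>, and \<open>delta H\<close> is not in \<open>V\<close>.
\<close>
theorem reducible_if_finite_index_overgroup: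
  assumes K: "subgroup K G" and HK: "H \<subset> K" and fin: "finite ((\<lambda>k. k <# H) ` K)"
  shows "\<not> irreducible_rep G X U"
proof
  assume irr: "irreducible_rep G X U"
  have KG: "K \<subseteq> carrier G" by (rule subgroup.subset[OF K])
  define V where "V = {f\<in>l2 X. \<forall>g\<in>carrier G. \<forall>k\<in>K. f ((g \<otimes> k) <# H) = f (g <# H)}"
  have Vc: "closed_subspace X V"
    unfolding closed_subspace_def
  proof (intro conjI allI impI ballI)
    fix s f assume s: "(\<forall>n::nat. s n \<in> V) \<and> f \<in> l2 X \<and>
      (\<lambda>n. l2_norm X (\<lambda>x. s n x - f x)) \<longlonglongrightarrow> 0"
    then have sl2: "s n \<in> l2 X" for n by (simp add: V_def)
    have f: "f \<in> l2 X" and lim0: "(\<lambda>n. l2_norm X (\<lambda>x. s n x - f x)) \<longlonglongrightarrow> 0" using s by auto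
    have lim: "(\<lambda>n. s n C) \<longlonglongrightarrow> f C" for C
    proof -
      have "cmod (s n C - f C) \<le> l2_norm X (\<lambda>x. s n x - f x)" for n
        using cmod_le_l2_norm[OF l2_diff[OF sl2 f], of n C] by simp
      then have "(\<lambda>n. s n C - f C) \<longlonglongrightarrow> 0"
        by (intro Lim_null_comparison[OF _ lim0] always_eventually allI)
      then show ?thesis by (simp add: LIM_zero_iff)
    qed
    have "f ((g \<otimes> k) <# H) = f (g <# H)" if "g \<in> carrier G" "k \<in> K" for g k
    proof -
      have "s n ((g \<otimes> k) <# H) = s n (g <# H)" for n using s that by (simp add: V_def)
      then show ?thesis using lim[of "(g \<otimes> k) <# H"] lim[of "g <# H"] LIMSEQ_unique by simp
    qed
    then show "f \<in> V" using f by (simp add: V_def)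
  qed (auto simp: V_def l2_add l2_scale)
  have "U u f \<in> V" if u: "u \<in> carrier G" and f: "f \<in> V" for u f
  proof -
    have fl2: "f \<in> l2 X" using f by (simp add: V_def)
    have "U u f ((g \<otimes> k) <# H) = U u f (g <# H)" if g: "g \<in> carrier G" and k: "k \<in> K" for g k
    proof -
      have kG: "k \<in> carrier G" using k KG by blast
      have "U u f ((g \<otimes> k) <# H) = f ((inv u \<otimes> g \<otimes> k) <# H)"
        using u g kG by (simp add: U_apply[OF fl2] coset_in_X lcos_m_assoc H_subset m_assoc)
      also have "\<dots> = f ((inv u \<otimes> g) <# H)" using f u g k by (simp add: V_def)
      also have "\<dots> = U u f (g <# H)"
        using u g by (simp add: U_apply[OF fl2] coset_in_X lcos_m_assoc H_subset)
      finally show ?thesis .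
    qed
    then show ?thesis using U_l2[OF u fl2] by (simp add: V_def)
  qed
  then have V: "invariant_subspace G X U V" using Vc by (simp add: invariant_subspace_def)
  have V_subset: "V \<subseteq> l2 X" by (auto simp: V_def)
  let ?S = "(\<lambda>k. k <# H) ` K"
  have mem_S: "g <# H \<in> ?S \<longleftrightarrow> g \<in> K" if g: "g \<in> carrier G" for g
  proof
    assume "g <# H \<in> ?S"
    then obtain k where k: "k \<in> K" "g <# H = k <# H" by blast
    then obtain h where "h \<in> H" "g = k \<otimes> h"
      using mem_coset[OF g] by (auto simp: l_coset_def)
    then show "g \<in> K" using k(1) HK subgroup.m_closed[OF K] by blast
  qed blast
  let ?f = "\<lambda>C. of_bool (C \<in> ?S) :: complex"
  have S_X: "?S \<subseteq> X" using KG by auto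
  have "(\<lambda>C. (cmod (?f C))\<^sup>2) summable_on X \<longleftrightarrow> (\<lambda>C. (cmod (?f C))\<^sup>2) summable_on ?S"
    by (rule summable_on_cong_neutral) (use S_X in auto)
  then have "?f \<in> l2 X" using fin S_X by (auto simp: l2_def)
  moreover have "?f ((g \<otimes> k) <# H) = ?f (g <# H)" if g: "g \<in> carrier G" and k: "k \<in> K" for g k
  proof -
    have kG: "k \<in> carrier G" using k KG by blast
    have "g \<otimes> k \<in> K \<longleftrightarrow> g \<in> K"
    proof
      assume "g \<otimes> k \<in> K"
      then have "g \<otimes> k \<otimes> inv k \<in> K"
        by (rule subgroup.m_closed[OF K _ subgroup.m_inv_closed[OF K k]])
      also have "g \<otimes> k \<otimes> inv k = g" using g kG by (simp add: m_assoc)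
      finally show "g \<in> K" .
    next
      assume "g \<in> K"
      then show "g \<otimes> k \<in> K" by (rule subgroup.m_closed[OF K _ k])
    qed
    then show ?thesis using mem_S[OF g] mem_S[OF m_closed[OF g kG]] by simp
  qed
  ultimately have f: "?f \<in> V" by (simp add: V_def)
  have f_H: "?f H \<noteq> 0"
    using mem_S[OF one_closed] subgroup.one_closed[OF K] H_subset by (simp add: lcos_mult_one)
  have "V \<noteq> {\<lambda>x. 0}"
  proof
    assume "V = {\<lambda>x. 0}"
    then have "?f = (\<lambda>x. 0)" using f by (simp only: singleton_iff)
    then show False using f_H by (rule fun_cong[THEN notE[rotated]])
  qed
  then have "V = l2 X"
    using irr V V_subset unfolding irreducible_rep_def irreducible_subrep_def by blast
  then have dV: "delta H \<in> V" using delta_l2[OF H_in_X] by simp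
  obtain k where k: "k \<in> K" "k \<notin> H" using HK by blast
  have kG: "k \<in> carrier G" using k(1) KG by blast
  have "delta H ((\<one> \<otimes> k) <# H) = delta H (\<one> <# H)" using dV k(1) unfolding V_def by blast
  then have "delta H (k <# H) = 1" using kG H_subset by (simp add: lcos_mult_one delta_def)
  then have "k <# H = H" by (simp add: delta_def split: if_splits)
  then show False using mem_coset[OF kG] k(2) by simp
qed

end

section \<open>Young subgroups\<close>

lemma sym_mult: "p \<otimes>\<^bsub>sym_group_inf\<^esub> q = p \<circ> q"
  by (simp add: sym_group_inf_def)

lemma sym_bij: "p \<in> carrier sym_group_inf \<Longrightarrow> bij p"
  using permutes_bij by (auto simp: mem_sym_group_inf')

lemma transpose_in_young:
  assumes P: "partition_on {1..} P" and A: "A \<in> P" and "a \<in> A" "b \<in> A"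
  shows "Transposition.transpose a b \<in> young_subgroup P"
proof -
  have "a \<in> {1..}" "b \<in> {1..}" using partition_onD1[OF P] assms by blast+
  then have "Transposition.transpose a b permutes {1..}" by (rule permutes_swap_id)
  moreover have "finite {x. Transposition.transpose a b x \<noteq> x}"
    by (rule finite_subset[of _ "{a, b}"]) (auto simp: Transposition.transpose_def)
  moreover have "Transposition.transpose a b ` B = B" if B: "B \<in> P" for B
  proof (cases "B = A")
    case True
    then show ?thesis using assms(3,4) by (intro transpose_image_eq) simp
  next
    case False
    then have "a \<notin> B" "b \<notin> B" using partition_onD2[OF P] A B assms(3,4) by (auto simp: disjoint_def)
    then show ?thesis by (intro transpose_image_eq) simp
  qed
  ultimately show ?thesis by (simp add: young_subgroup_def mem_sym_group_inf')
qed

text \<open>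
  A partition of the positive integers into blocks; \<open>coset g\<close> is the left coset of \<open>g\<close> modulo its
  Young subgroup.
\<close>
locale young_partition =
  fixes P :: "nat set set"
  assumes part: "partition_on {1..} P"
begin

sublocale coset_rep sym_group_inf "young_subgroup P"
  by (intro coset_rep.intro coset_rep_axioms.intro group_sym_group_inf subgroup_young_subgroup)

abbreviation S where "S \<equiv> carrier sym_group_inf"
abbreviation coset where "coset g \<equiv> g <#\<^bsub>sym_group_inf\<^esub> young_subgroup P"

lemma block_nonempty: "A \<in> P \<Longrightarrow> A \<noteq> {}"
  using partition_onD3[OF part] by blast

lemma block_disjoint: "A \<in> P \<Longrightarrow> B \<in> P \<Longrightarrow> x \<in> A \<Longrightarrow> x \<in> B \<Longrightarrow> A = B"
  using partition_onD2[OF part] by (auto simp: disjoint_def)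

lemma block_subset: "A \<in> P \<Longrightarrow> A \<subseteq> {1..}"
  using partition_onD1[OF part] by blast

text \<open>
  A coset of the Young subgroup is the same as the family of images of the blocks.
\<close>
lemma coset_eq_iff:
  assumes g: "g \<in> S" and g': "g' \<in> S"
  shows "coset g = coset g' \<longleftrightarrow> (\<forall>A\<in>P. g ` A = g' ` A)"
proof
  assume "coset g = coset g'"
  then have "g \<in> coset g'" using mem_coset[OF g] by simp
  then obtain h where h: "h \<in> young_subgroup P" "g = g' \<circ> h" by (auto simp: l_coset_def sym_mult)
  show "\<forall>A\<in>P. g ` A = g' ` A"
  proof
    fix A assume "A \<in> P"
    then have "h ` A = A" using h(1) by (simp add: young_subgroup_def)
    moreover have "g ` A = g' ` h ` A" unfolding h(2) by (rule image_comp[symmetric])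
    ultimately show "g ` A = g' ` A" by simp
  qed
next
  assume eq: "\<forall>A\<in>P. g ` A = g' ` A"
  let ?i = "inv\<^bsub>sym_group_inf\<^esub> g'"
  let ?h = "?i \<otimes>\<^bsub>sym_group_inf\<^esub> g"
  have h: "?h \<in> S" using g g' by simp
  have "?i \<circ> g' = id"
    using l_inv[OF g'] by (simp add: sym_mult) (simp add: sym_group_inf_def)
  have "?h ` A = A" if "A \<in> P" for A
  proof -
    have "?h ` A = ?i ` g ` A" unfolding sym_mult by (rule image_comp[symmetric])
    also have "\<dots> = ?i ` g' ` A" using eq that by simp
    also have "\<dots> = (?i \<circ> g') ` A" by (rule image_comp)
    finally show ?thesis using \<open>?i \<circ> g' = id\<close> by simp
  qed
  then have "?h \<in> young_subgroup P" using h by (simp add: young_subgroup_def)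
  then have "coset ?h = young_subgroup P" by (rule H_translate)
  moreover have "g = g' \<otimes>\<^bsub>sym_group_inf\<^esub> ?h" using g g' by (simp add: m_assoc[symmetric])
  ultimately show "coset g = coset g'"
    using lcos_m_assoc[OF H_subset g' h] by simp
qed

text \<open>
  If \<open>g A \<noteq> A\<close>, there is a point \<open>a\<close> of \<open>A\<close> outside \<open>g A\<close>. Transposing \<open>a\<close> with a point \<open>b\<close> of \<open>A\<close> not
  moved by \<open>g\<close> replaces \<open>b\<close> by \<open>a\<close> in \<open>g A\<close>, so different \<open>b\<close> give different cosets in the orbit
  of \<open>coset g\<close>.
\<close>
lemma finite_orbit_fixes_infinite_blocks:
  assumes g: "g \<in> S" and orb: "coset g \<in> finite_orbits" and A: "A \<in> P" "infinite A"
  shows "g ` A = A"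
proof (rule ccontr)
  assume neq: "g ` A \<noteq> A"
  obtain n where n: "g permutes {1..n}" using g by (auto simp: mem_sym_group_inf)
  note inj = permutes_inj[OF n]
  have out: "g x = x" if "x \<notin> {1..n}" for x using permutes_not_in[OF n that] .
  have in_iff: "g x \<in> {1..n} \<longleftrightarrow> x \<in> {1..n}" for x using permutes_in_image[OF n] .
  have split: "g ` A = g ` (A \<inter> {1..n}) \<union> (A - {1..n})"
  proof -
    have "g ` (A - {1..n}) = A - {1..n}" using out by force
    then show ?thesis by (metis Un_Diff_Int image_Un inf_commute sup_commute)
  qed
  \<comment> \<open>The parts of \<open>A\<close> and \<open>g A\<close> inside the support have the same finite cardinality.\<close>
  have "\<not> A \<subseteq> g ` A"
  proof
    assume sub: "A \<subseteq> g ` A"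
    have "A \<inter> {1..n} \<subseteq> g ` (A \<inter> {1..n})" using sub in_iff by blast
    moreover have "card (g ` (A \<inter> {1..n})) = card (A \<inter> {1..n})"
      by (rule card_image) (rule inj_on_subset[OF inj], simp)
    ultimately have "g ` (A \<inter> {1..n}) = A \<inter> {1..n}" by (metis card_subset_eq finite_Int finite_atLeastAtMost finite_imageI)
    then show False using split neq by blast
  qed
  then obtain a where a: "a \<in> A" "a \<notin> g ` A" by blast
  let ?B = "A - {1..n}"
  let ?t = "Transposition.transpose a"
  have tY: "?t b \<in> young_subgroup P" if "b \<in> ?B" for b
    using transpose_in_young[OF part A(1) a(1)] that by blast
  have tS: "?t b \<in> S" if "b \<in> ?B" for b using tY[OF that] H_subset by blast
  have "inj_on (\<lambda>b. ?t b <#\<^bsub>sym_group_inf\<^esub> coset g) ?B"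
  proof (rule inj_onI, rule ccontr)
    fix b c assume b: "b \<in> ?B" and c: "c \<in> ?B" and bc: "b \<noteq> c"
      and eq: "?t b <#\<^bsub>sym_group_inf\<^esub> coset g = ?t c <#\<^bsub>sym_group_inf\<^esub> coset g"
    have bg: "b \<in> g ` A" using out[of b] b by (metis DiffD1 DiffD2 image_eqI)
    have ab: "a \<noteq> b" using a(2) bg by blast
    have "coset (?t b \<circ> g) = coset (?t c \<circ> g)"
      using eq lcos_m_assoc[OF H_subset tS[OF b] g] lcos_m_assoc[OF H_subset tS[OF c] g]
      by (simp add: sym_mult)
    moreover have "?t b \<circ> g \<in> S" "?t c \<circ> g \<in> S"
      using m_closed[OF tS[OF b] g] m_closed[OF tS[OF c] g] by (simp_all add: sym_mult)
    ultimately have "(?t b \<circ> g) ` A = (?t c \<circ> g) ` A" using coset_eq_iff A(1) by blast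
    moreover have "b \<in> (?t c \<circ> g) ` A"
    proof -
      have "?t c b = b" using ab bc by (simp add: Transposition.transpose_def)
      then show ?thesis using bg by (metis image_comp image_eqI)
    qed
    moreover have "b \<notin> (?t b \<circ> g) ` A"
      using a(2) ab by (auto simp: Transposition.transpose_def split: if_splits)
    ultimately show False by blast
  qed
  moreover have "infinite ?B" using A(2) by simp
  ultimately have "infinite ((\<lambda>b. ?t b <#\<^bsub>sym_group_inf\<^esub> coset g) ` ?B)"
    using finite_imageD by blast
  moreover have "(\<lambda>b. ?t b <#\<^bsub>sym_group_inf\<^esub> coset g) ` ?B \<subseteq>
      (\<lambda>h. h <#\<^bsub>sym_group_inf\<^esub> coset g) ` young_subgroup P"
    using tY by blast
  ultimately show False using orb finite_subset by (auto simp: finite_orbits_def)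
qed

text \<open>
  The set of finite blocks of the partition.
\<close>
definition finite_blocks where
  "finite_blocks = {A\<in>P. finite A}"

lemma image_finite_block:
  assumes g: "g \<in> S" and fix_inf: "\<And>A. A \<in> P \<Longrightarrow> infinite A \<Longrightarrow> g ` A = A"
    and A: "A \<in> finite_blocks"
  shows "g ` A \<subseteq> \<Union>finite_blocks"
proof (rule image_subsetI)
  fix x assume x: "x \<in> A"
  have AP: "A \<in> P" "finite A" using A by (auto simp: finite_blocks_def)
  have "g permutes {1..}" using g by (simp add: mem_sym_group_inf')
  then have "g x \<in> {1..}" using x block_subset[OF AP(1)] permutes_in_image by fastforce
  then obtain B where B: "B \<in> P" "g x \<in> B" using partition_onD1[OF part] by blast
  have "finite B"
  proof (rule ccontr)
    assume inf: "infinite B"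
    then have "g x \<in> g ` B" using fix_inf B by blast
    then have "x \<in> B" using bij_is_inj[OF sym_bij[OF g]] by (simp add: inj_image_mem_iff)
    then show False using block_disjoint[OF AP(1) B(1) x] AP(2) inf by blast
  qed
  then show "g x \<in> \<Union>finite_blocks" using B by (auto simp: finite_blocks_def)
qed

text \<open>
  A coset in a finite orbit is determined by the images of the finite blocks, as the infinite blocks
  are fixed; these images are subsets of a fixed finite set.
\<close>
lemma finite_finite_orbits:
  assumes fin: "finite finite_blocks"
  shows "finite finite_orbits"
proof -
  let ?N = "{g\<in>S. \<forall>A\<in>P. infinite A \<longrightarrow> g ` A = A}"
  let ?p = "\<lambda>g. \<lambda>A\<in>finite_blocks. g ` A"
  have "finite (\<Union>finite_blocks)" using fin by (auto simp: finite_blocks_def)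
  then have "finite (finite_blocks \<rightarrow>\<^sub>E Pow (\<Union>finite_blocks))"
    using fin by (intro finite_PiE) auto
  moreover have "?p ` ?N \<subseteq> finite_blocks \<rightarrow>\<^sub>E Pow (\<Union>finite_blocks)"
  proof (rule image_subsetI, rule restrict_PiE_iff[THEN iffD2], rule ballI, rule PowI)
    fix g A assume "g \<in> ?N" "A \<in> finite_blocks"
    then show "g ` A \<subseteq> \<Union>finite_blocks" by (intro image_finite_block) auto
  qed
  ultimately have "finite (?p ` ?N)" by (rule rev_finite_subset)
  then have "finite (coset ` ?N)"
  proof (rule finite_image_factor)
    fix g g' assume g: "g \<in> ?N" and g': "g' \<in> ?N" and eq: "?p g = ?p g'"
    have "g ` A = g' ` A" if A: "A \<in> P" for A
    proof (cases "finite A")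
      case True
      then have "A \<in> finite_blocks" using A by (simp add: finite_blocks_def)
      then show ?thesis using fun_cong[OF eq, of A] by simp
    next
      case False
      then show ?thesis using g g' A by simp
    qed
    then show "coset g = coset g'" using coset_eq_iff g g' by simp
  qed
  moreover have "finite_orbits \<subseteq> coset ` ?N"
  proof
    fix C assume C: "C \<in> finite_orbits"
    then obtain g where g: "g \<in> S" "C = coset g"
      using coset_obtain[of C] by (auto simp: finite_orbits_def)
    then show "C \<in> coset ` ?N" using finite_orbit_fixes_infinite_blocks C by blast
  qed
  ultimately show ?thesis by (rule rev_finite_subset)
qed

lemma single_finite_orbit:
  assumes single: "\<And>A B. A \<in> finite_blocks \<Longrightarrow> B \<in> finite_blocks \<Longrightarrow> A = B"
  shows "finite_orbits \<subseteq> {young_subgroup P}"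
proof
  fix C assume C: "C \<in> finite_orbits"
  then obtain g where g: "g \<in> S" "C = coset g"
    using coset_obtain[of C] by (auto simp: finite_orbits_def)
  have fix_inf: "g ` A = A" if "A \<in> P" "infinite A" for A
    using finite_orbit_fixes_infinite_blocks g C that by blast
  have "g ` A = A" if A: "A \<in> P" for A
  proof (cases "finite A")
    case True
    then have Af: "A \<in> finite_blocks" using A by (simp add: finite_blocks_def)
    then have "finite_blocks = {A}" using single by blast
    then have "g ` A \<subseteq> A" using image_finite_block[OF g(1) fix_inf Af] by simp
    moreover have "card (g ` A) = card A"
      by (rule card_image) (rule inj_on_subset[OF bij_is_inj[OF sym_bij[OF g(1)]]], simp)
    ultimately show ?thesis using True by (simp add: card_subset_eq)
  qed (rule fix_inf[OF A])
  then have "g \<in> young_subgroup P" using g(1) by (simp add: young_subgroup_def)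
  then show "C \<in> {young_subgroup P}" using H_translate g(2) by simp
qed

text \<open>
  The overgroup \<open>?K\<close> is the Young subgroup of the partition in which \<open>A\<close> and \<open>B\<close> are merged. A coset
  of an element \<open>k\<close> of \<open>?K\<close> is determined by \<open>k A \<subseteq> A \<union> B\<close>, so the index is finite.
\<close>
lemma reducible_if_two_finite_blocks:
  assumes A: "A \<in> finite_blocks" and B: "B \<in> finite_blocks" and AB: "A \<noteq> B"
  shows "\<not> irreducible_rep sym_group_inf X U"
proof (rule reducible_if_finite_index_overgroup)
  have AP: "A \<in> P" "finite A" and BP: "B \<in> P" "finite B" using A B by (auto simp: finite_blocks_def)
  have disj: "A \<inter> B = {}" using block_disjoint AP BP AB by blast
  let ?Q = "insert (A \<union> B) (P - {A, B})"
  let ?K = "young_subgroup ?Q"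
  show "subgroup ?K sym_group_inf" by (rule subgroup_young_subgroup)
  have Q: "partition_on {1..} ?Q"
  proof (rule partition_onI)
    show "\<Union>?Q = {1..}" using partition_onD1[OF part] AP BP by auto
    show "{} \<notin> ?Q" using block_nonempty AP by blast
    show "disjnt p q" if "p \<in> ?Q" "q \<in> ?Q" "p \<noteq> q" for p q
      unfolding disjnt_iff
    proof (intro allI notI)
      fix x assume x: "x \<in> p \<and> x \<in> q"
      have key: "C = A \<or> C = B" if "C \<in> P" "x \<in> C" "x \<in> A \<union> B" for C
        using block_disjoint[OF that(1) AP(1) that(2)] block_disjoint[OF that(1) BP(1) that(2)] that(3)
        by blast
      show False
        using \<open>p \<in> ?Q\<close> \<open>q \<in> ?Q\<close> \<open>p \<noteq> q\<close> x key[of p] key[of q] block_disjoint[of p q x] by auto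
    qed
  qed
  have sub: "young_subgroup P \<subseteq> ?K"
    using AP BP by (auto simp: young_subgroup_def image_Un)
  obtain a b where ab: "a \<in> A" "b \<in> B" using block_nonempty AP BP by blast
  let ?t = "Transposition.transpose a b"
  have "?t \<in> ?K" using ab by (intro transpose_in_young[OF Q, of "A \<union> B"]) auto
  moreover have "?t \<notin> young_subgroup P"
  proof
    assume "?t \<in> young_subgroup P"
    then have "?t ` A = A" using AP by (simp add: young_subgroup_def)
    moreover have "b \<in> ?t ` A" using ab by (auto simp: image_iff Transposition.transpose_def intro: bexI[of _ a])
    ultimately show False using ab disj by blast
  qed
  ultimately show "young_subgroup P \<subset> ?K" using sub by blast
  show "finite (coset ` ?K)"
  proof (rule finite_image_factor[where p = "\<lambda>k. k ` A"])
    have "(\<lambda>k. k ` A) ` ?K \<subseteq> Pow (A \<union> B)" by (auto simp: young_subgroup_def)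
    then show "finite ((\<lambda>k. k ` A) ` ?K)"
      by (rule finite_subset) (simp add: AP BP)
  next
    fix k k' assume k: "k \<in> ?K" and k': "k' \<in> ?K" and eq: "k ` A = k' ` A"
    have kS: "k \<in> S" "k' \<in> S" using k k' by (auto simp: young_subgroup_def)
    have imB: "j ` B = (A \<union> B) - j ` A" if j: "j \<in> ?K" for j
    proof -
      have "j ` (A \<union> B) = A \<union> B" using j by (simp add: young_subgroup_def)
      then have "j ` A \<union> j ` B = A \<union> B" by (simp add: image_Un)
      moreover have "inj j" using j by (simp add: young_subgroup_def bij_is_inj sym_bij)
      then have "j ` A \<inter> j ` B = {}" using disj by (simp flip: image_Int)
      ultimately show ?thesis by blast
    qed
    have "k ` C = k' ` C" if C: "C \<in> P" for C
    proof -
      consider "C = A" | "C = B" | "C \<in> ?Q" using C by blast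
      then show ?thesis
      proof cases
        case 2 then show ?thesis using imB[OF k] imB[OF k'] eq by simp
      next
        case 3
        have "j ` C = C" if "j \<in> ?K" for j
        proof -
          have "\<forall>D\<in>?Q. j ` D = D" 
            using that unfolding young_subgroup_def mem_Collect_eq by (rule conjunct2)
          then show ?thesis by (rule bspec) (rule 3)
        qed
        then show ?thesis using k k' by simp
      qed (simp add: eq)
    qed
    then show "coset k = coset k'" using coset_eq_iff[OF kS] by blast
  qed
qed

end

section \<open>Type I and irreducibility criteria\<close>

theorem theorem1:
  fixes P :: "nat set set" and k :: "enat \<Rightarrow> enat"
  assumes "partition_of_type P k"
  shows "let X = lcosets\<^bsub>sym_group_inf\<^esub> (young_subgroup P);
             I = induced_trivial sym_group_inf (young_subgroup P)
         in ((\<Sum>i. k (enat (Suc i))) < \<infinity> \<longrightarrow>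
               type_I_rep sym_group_inf X I \<and> finite_sum_of_irreducibles sym_group_inf X I) \<and>
            (irreducible_rep sym_group_inf X I \<longleftrightarrow> (\<Sum>i. k (enat (Suc i))) \<le> 1)"
proof -
  interpret young_partition P
    by (rule young_partition.intro) (use assms in \<open>simp add: partition_of_type_def\<close>)
  have sum: "(\<Sum>i. k (enat (Suc i))) = ecard finite_blocks"
    unfolding finite_blocks_def by (rule sum_finite_blocks[OF assms])
  have "type_I_rep sym_group_inf X U \<and> finite_sum_of_irreducibles sym_group_inf X U"
    if "ecard finite_blocks < \<infinity>"
  proof -
    have "finite finite_blocks" using that by (simp add: ecard_def split: if_splits)
    then show ?thesis
      using finite_finite_orbits type_I_if_finite_orbits finite_sum_if_finite_orbits by blast
  qed
  moreover have "irreducible_rep sym_group_inf X U \<longleftrightarrow> ecard finite_blocks \<le> 1"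
  proof
    assume irr: "irreducible_rep sym_group_inf X U"
    have "A = B" if "A \<in> finite_blocks" "B \<in> finite_blocks" for A B
      using reducible_if_two_finite_blocks[OF that] irr by blast
    then have "finite_blocks = {} \<or> (\<exists>A. finite_blocks = {A})" by blast
    then show "ecard finite_blocks \<le> 1" by (auto simp: ecard_def one_enat_def)
  next
    assume "ecard finite_blocks \<le> 1"
    then have "finite finite_blocks" "card finite_blocks \<le> Suc 0"
      by (auto simp: ecard_def one_enat_def split: if_splits)
    then show "irreducible_rep sym_group_inf X U"
      by (intro irreducible_if_single_finite_orbit single_finite_orbit) (simp add: card_le_Suc0_iff_eq)
  qed
  ultimately show ?thesis unfolding Let_def sum by blast
qed

end
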